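(* Let $F:\mathbb{R}^n\to\mathbb{R}$ be a convex differentiable function admitting a unique minimizer, and let $F^*=\min F$. Let $\alpha>0$, $\theta\in[0,1]$, $t_0>0$, $(x_0,v_0)\in\mathbb{R}^n\times\mathbb{R}^n$, let $g:[t_0,+\infty)\to\mathbb{R}^n$ be integrable, and let $x$ be the solution on $[t_0,+\infty)$ of $$\ddot x(t)+\frac{\alpha}{t^\theta}\dot x(t)+\nabla F(x(t))=g(t)$$ with $(x(t_0),\dot x(t_0))=(x_0,v_0)$. Let $\gamma_1>2$, $\gamma_2\ge\gamma_1$ and $r=\frac{1+\theta}{2}$. Assume that $$\int_{t_0}^{+\infty}t^{\frac{r\gamma_2}{\gamma_2-2}}\|g(t)\|\,dt<+\infty ,$$ that $F$ satisfies $\mathbf{H}_1(\gamma_1)$ and $\mathbf{H}_2(\gamma_2)$, and that one of the following holds: 1. $\theta=1$ and $\alpha\ge\frac{\gamma_1+2}{\gamma_1-2}$; or 2. $\theta<1$. Then, as $t\to+\infty$, $$F(x(t))-F^*=O\!\left(\frac{1}{t^{\frac{2r\gamma_2}{\gamma_2-2}}}\right).$$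
   Context: $\mathbb{R}^n$ carries the Euclidean scalar product $\langle\cdot,\cdot\rangle$ and norm $\|\cdot\|$; $B(x^*,\rho)$ is the open ball of center $x^*$ and radius $\rho$; $X^*=\operatorname{argmin}F$; $d(x,X^* )$ is the distance from $x$ to $X^*$; $F^*=\inf F$. Condition $\mathbf{H}_1(\gamma)$ ($\gamma\ge1$): for any minimizer $x^*\in X^*$ there exists $\eta>0$ such that for all $x\in B(x^*,\eta)$, $F(x)-F^*\le\frac1\gamma\langle\nabla F(x),x-x^*\rangle$. Condition $\mathbf{H}_2(r)$ ($r\ge1$): for any minimizer $x^*\in X^*$ there exist $K_r>0$ and $\epsilon>0$ such that for all $x\in B(x^*,\epsilon)$, $K_r\,d(x,X^* )^r\le F(x)-F^*$. Standing assumption: for any initial conditions $(x_0,v_0)\in\mathbb{R}^n\times\mathbb{R}^n$, the Cauchy problem for the differential equation has a unique global solution on $[t_0,+\infty)$ with $(x(t_0),\dot x(t_0))=(x_0,v_0)$. *)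

theory Defs
  imports "HOL-Analysis.Analysis" "HOL-Library.Landau_Symbols"
begin

text \<open>Well defined wherever \<open>F\<close> is differentiable, see \<open>gderiv_gradient\<close>.\<close>

definition gradient :: "('a::euclidean_space \<Rightarrow> real) \<Rightarrow> 'a \<Rightarrow> 'a" where
  "gradient F x = (THE d. GDERIV F x :> d)"

lemma gderiv_gradient:
  fixes F :: "'a::euclidean_space \<Rightarrow> real"
  assumes "F differentiable (at x)"
  shows "GDERIV F x :> gradient F x"
  unfolding gradient_def
proof (rule theI')
  from assms obtain L where L: "(F has_derivative L) (at x)"
    by (auto simp: differentiable_def)
  then interpret bounded_linear L
    by (rule has_derivative_bounded_linear)
  have "L h = h \<bullet> (\<Sum>b\<in>Basis. L b *\<^sub>R b)" for h
  proof -
    have "L h = L (\<Sum>b\<in>Basis. (h \<bullet> b) *\<^sub>R b)"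
      by (simp add: euclidean_representation)
    then show ?thesis
      by (simp add: sum scaleR inner_sum_right mult.commute)
  qed
  then have "L = (\<lambda>h. h \<bullet> (\<Sum>b\<in>Basis. L b *\<^sub>R b))"
    by blast
  with L have ex: "GDERIV F x :> (\<Sum>b\<in>Basis. L b *\<^sub>R b)"
    by (simp add: gderiv_def)
  show "\<exists>!d. GDERIV F x :> d"
  proof (rule ex1I, rule ex)
    fix d assume "GDERIV F x :> d"
    with ex have "(\<lambda>h. h \<bullet> d) = (\<lambda>h. h \<bullet> (\<Sum>b\<in>Basis. L b *\<^sub>R b))"
      unfolding gderiv_def by (rule has_derivative_unique[rotated])
    then show "d = (\<Sum>b\<in>Basis. L b *\<^sub>R b)"
      by (metis vector_eq_ldot)
  qed
qed

definition minimizers :: "('a \<Rightarrow> real) \<Rightarrow> 'a set" where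
  "minimizers F = {x. \<forall>y. F x \<le> F y}"

definition inf_value :: "('a \<Rightarrow> real) \<Rightarrow> real" where
  "inf_value F = (INF x. F x)"

definition H1 :: "real \<Rightarrow> ('a::euclidean_space \<Rightarrow> real) \<Rightarrow> bool" where
  "H1 \<gamma> F \<longleftrightarrow>
     (\<forall>xs \<in> minimizers F. \<exists>\<eta>>0. \<forall>x \<in> ball xs \<eta>.
        F x - inf_value F \<le> (1 / \<gamma>) * (gradient F x \<bullet> (x - xs)))"

definition H2 :: "real \<Rightarrow> ('a::euclidean_space \<Rightarrow> real) \<Rightarrow> bool" where
  "H2 r F \<longleftrightarrow>
     (\<forall>xs \<in> minimizers F. \<exists>K>0. \<exists>\<epsilon>>0. \<forall>x \<in> ball xs \<epsilon>.
        K * infdist x (minimizers F) powr r \<le> F x - inf_value F)"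

text \<open>
  Absolute continuity of \<open>v\<close> on \<open>[a, b]\<close>. A pair \<open>(s, t)\<close> in \<open>P\<close> stands for the
  interval \<open>[s, t]\<close>; the intervals of \<open>P\<close> may only share end points.
\<close>

definition abs_continuous_on_interval ::
    "real \<Rightarrow> real \<Rightarrow> (real \<Rightarrow> 'a::real_normed_vector) \<Rightarrow> bool" where
  "abs_continuous_on_interval a b v \<longleftrightarrow>
     (\<forall>\<epsilon>>0. \<exists>\<delta>>0. \<forall>P.
        finite P \<and> (\<forall>(s, t) \<in> P. a \<le> s \<and> s \<le> t \<and> t \<le> b) \<and>
        disjoint_family_on (\<lambda>(s, t). {s<..<t}) P \<and>
        (\<Sum>(s, t) \<in> P. t - s) < \<delta>
        \<longrightarrow> (\<Sum>(s, t) \<in> P. norm (v t - v s)) < \<epsilon>)"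

text \<open>
  \<open>x\<close> solves \<open>x'' + \<alpha> / t^\<theta> x' + \<nabla>F(x) = g\<close> on \<open>[t0, \<infinity>)\<close> with data \<open>(x0, v0)\<close>.
  Since \<open>g\<close> is merely integrable, solutions are understood in the sense of
  Caratheodory: \<open>x\<close> is differentiable everywhere with locally absolutely continuous
  derivative \<open>v\<close>, and the equation holds for almost every \<open>t\<close>. A twice differentiable
  \<open>x\<close> satisfying the equation at every \<open>t\<close> is in particular such a solution when
  \<open>F\<close> is convex and differentiable and \<open>g\<close> is integrable.
  At \<open>t0\<close> the derivative is one-sided; values of \<open>x\<close> before \<open>t0\<close> are irrelevant.
\<close>

definition is_solution ::
    "('a::euclidean_space \<Rightarrow> real) \<Rightarrow> (real \<Rightarrow> 'a) \<Rightarrow> real \<Rightarrow> real \<Rightarrow> real \<Rightarrow> 'a \<Rightarrow> 'a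
      \<Rightarrow> (real \<Rightarrow> 'a) \<Rightarrow> bool" where
  "is_solution F g \<alpha> \<theta> t0 x0 v0 x \<longleftrightarrow>
     (\<exists>v.
        (\<forall>t\<ge>t0. (x has_vector_derivative v t) (at t within {t0..})) \<and>
        x t0 = x0 \<and> v t0 = v0 \<and>
        (\<forall>T\<ge>t0. abs_continuous_on_interval t0 T v) \<and>
        (AE t in lebesgue. t \<ge> t0 \<longrightarrow>
           (\<exists>a. (v has_vector_derivative a) (at t within {t0..}) \<and>
                a + (\<alpha> / t powr \<theta>) *\<^sub>R v t + gradient F (x t) = g t)))"

definition globally_well_posed ::
    "('a::euclidean_space \<Rightarrow> real) \<Rightarrow> (real \<Rightarrow> 'a) \<Rightarrow> real \<Rightarrow> real \<Rightarrow> real \<Rightarrow> bool" where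
  "globally_well_posed F g \<alpha> \<theta> t0 \<longleftrightarrow>
     (\<forall>x0 v0. \<exists>x. is_solution F g \<alpha> \<theta> t0 x0 v0 x \<and>
        (\<forall>y. is_solution F g \<alpha> \<theta> t0 x0 v0 y \<longrightarrow> (\<forall>t\<ge>t0. y t = x t)))"

end

theory Submission
  imports Defs
begin

text \<open>
  With \<open>y = x - x\<^sup>*\<close>, \<open>w = (l / t) y + x'\<close> and \<open>\<xi>(t) = l (l + 1) / t\<^sup>2 - l \<alpha> / t\<^bsup>1 + \<theta>\<^esup>\<close>, consider
  the energy \<open>t\<^bsup>c\<^esup> (F(x) - F\<^sup>* + \<parallel>w\<parallel>\<^sup>2 / 2 + \<xi> \<parallel>y\<parallel>\<^sup>2 / 2)\<close>. Three choices of \<open>(c, l)\<close> suffice.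
  For \<open>c = l = 0\<close> it is the mechanical energy and gives boundedness of \<open>x\<close> and \<open>x'\<close>. For
  small \<open>c = l > 0\<close> convexity alone shows \<open>F(x(t)) \<rightarrow> F\<^sup>*\<close>, so the trajectory
  enters the neighbourhoods on which the two local conditions hold. For
  \<open>l = 2 / (\<gamma>1 - 2)\<close> and \<open>c = 2 l + 2 = \<gamma>1 l\<close> the flatness condition makes every term of the
  derivative nonpositive except the one containing \<open>g\<close>. There \<open>\<xi>\<close> may be negative, but
  the growth condition bounds \<open>\<parallel>y\<parallel>\<^sup>2\<close> by a power \<open>2 / \<gamma>2 < 1\<close> of \<open>F(x) - F\<^sup>*\<close>, which is
  absorbed after dividing by a power of \<open>t\<close>.
\<close>

section \<open>Absolutely continuous functions\<close>

text \<open>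
  Cousin's lemma: intervals tagged in the exceptional set are handled by absolute
  continuity, all others by the derivative at their tag.
\<close>

lemma abs_continuous_increment_le_integral:
  fixes f \<phi> :: "real \<Rightarrow> real"
  assumes ab: "a \<le> b" and ac: "abs_continuous_on_interval a b f" and N: "negligible N"
    and der: "\<And>t. t \<in> {a..b} \<Longrightarrow> t \<notin> N \<Longrightarrow>
      \<exists>f'. (f has_real_derivative f') (at t within {a..b}) \<and> f' \<le> \<phi> t"
    and \<phi>: "\<phi> integrable_on {a..b}"
  shows "f b - f a \<le> integral {a..b} \<phi>"
proof (rule field_le_epsilon)
  fix e :: real assume "e > 0"
  \<comment> \<open>The budget \<open>e\<close> is split into three thirds: intervals tagged in
    \<open>N\<close>, the Riemann sum, and the slack \<open>\<epsilon> * (b - a)\<close>. The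
    \<open>+ 1\<close> keeps the denominator positive when \<open>a = b\<close>.\<close>
  define \<epsilon> where "\<epsilon> = e / (3 * (b - a + 1))"
  have \<epsilon>: "\<epsilon> > 0" "\<epsilon> * (b - a) \<le> e / 3"
    using \<open>e > 0\<close> ab by (auto simp: \<epsilon>_def field_simps)
  \<comment> \<open>Straddle estimate: the tag \<open>t\<close> lies between \<open>s\<close> and
    \<open>u\<close>, so the errors of the linear approximation on its two sides add up to at most
    \<open>\<epsilon> * (u - s)\<close>.\<close>
  have "\<forall>t\<in>{a..b} - N. \<exists>d>0. \<forall>s u. a \<le> s \<and> s \<le> t \<and> t \<le> u \<and> u \<le> b \<and> \<bar>s - t\<bar> < d \<and> \<bar>u - t\<bar> < d
      \<longrightarrow> f u - f s \<le> (\<phi> t + \<epsilon>) * (u - s)"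
  proof
    fix t assume t: "t \<in> {a..b} - N"
    then obtain f' where f': "(f has_real_derivative f') (at t within {a..b})" "f' \<le> \<phi> t"
      using der by blast
    from f'(1) have "(f has_derivative (\<lambda>h. f' * h)) (at t within {a..b})"
      by (simp add: has_field_derivative_def)
    then obtain d where d: "d > 0"
      "\<And>y. y \<in> {a..b} \<Longrightarrow> \<bar>y - t\<bar> < d \<Longrightarrow> \<bar>f y - f t - f' * (y - t)\<bar> \<le> \<epsilon> * \<bar>y - t\<bar>"
      using \<epsilon>(1) unfolding has_derivative_within_alt by (auto simp: real_norm_def)
    have "f u - f s \<le> (\<phi> t + \<epsilon>) * (u - s)"
      if "a \<le> s \<and> s \<le> t \<and> t \<le> u \<and> u \<le> b \<and> \<bar>s - t\<bar> < d \<and> \<bar>u - t\<bar> < d" for s u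
    proof -
      have "f u - f s \<le> (f' + \<epsilon>) * (u - s)"
        using d(2)[of s] d(2)[of u] that t by (auto simp: algebra_simps abs_le_iff)
      also have "\<dots> \<le> (\<phi> t + \<epsilon>) * (u - s)"
        using f'(2) that by (intro mult_right_mono) auto
      finally show ?thesis .
    qed
    with d(1) show "\<exists>d>0. \<forall>s u. a \<le> s \<and> s \<le> t \<and> t \<le> u \<and> u \<le> b \<and> \<bar>s - t\<bar> < d \<and> \<bar>u - t\<bar> < d
      \<longrightarrow> f u - f s \<le> (\<phi> t + \<epsilon>) * (u - s)" by blast
  qed
  then obtain d where d: "\<And>t. t \<in> {a..b} - N \<Longrightarrow> d t > 0"
    and d_le: "\<And>t s u. t \<in> {a..b} - N \<Longrightarrow> a \<le> s \<Longrightarrow> s \<le> t \<Longrightarrow> t \<le> u \<Longrightarrow> u \<le> b \<Longrightarrow>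
      \<bar>s - t\<bar> < d t \<Longrightarrow> \<bar>u - t\<bar> < d t \<Longrightarrow> f u - f s \<le> (\<phi> t + \<epsilon>) * (u - s)"
    by metis
  obtain \<delta> where "\<delta> > 0" and \<delta>: "\<And>P. finite P \<Longrightarrow> (\<forall>(s, t) \<in> P. a \<le> s \<and> s \<le> t \<and> t \<le> b) \<Longrightarrow>
        disjoint_family_on (\<lambda>(s, t). {s<..<t}) P \<Longrightarrow>
        (\<Sum>(s, t) \<in> P. t - s) < \<delta> \<Longrightarrow> (\<Sum>(s, t) \<in> P. norm (f t - f s)) < e / 3"
    using ac[unfolded abs_continuous_on_interval_def, rule_format, of "e / 3"] \<open>e > 0\<close> by auto
  have "N \<in> sets lebesgue" using N negligible_imp_sets by blast
  then obtain U where U: "open U" "N \<subseteq> U" "(U - N) \<in> lmeasurable"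
    and em: "emeasure lebesgue (U - N) < ennreal \<delta>"
    using sets_lebesgue_outer_open[OF _ \<open>\<delta> > 0\<close>] by blast
  have emU: "emeasure lebesgue U < ennreal \<delta>"
  proof -
    have "emeasure lebesgue U = emeasure lebesgue (U - N \<union> N)"
      using U(2) by (simp add: Un_absorb2)
    also have "\<dots> \<le> emeasure lebesgue (U - N) + emeasure lebesgue N"
      using U(3) \<open>N \<in> sets lebesgue\<close> by (intro emeasure_subadditive) (auto simp: fmeasurable_def)
    also have "emeasure lebesgue N = 0" using N
      by (simp add: negligible_iff_null_sets null_sets_def)
    finally show ?thesis using em by simp
  qed
  \<comment> \<open>Setting \<open>\<phi>\<close> to zero on \<open>N\<close> leaves its integral
    unchanged and removes the tags in \<open>N\<close> from the Riemann sum.\<close>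
  define \<phi>0 where "\<phi>0 = (\<lambda>t. if t \<in> N then 0 else \<phi> t)"
  have "(\<phi>0 has_integral integral {a..b} \<phi>) {a..b}"
    by (rule has_integral_spike[OF N _ integrable_integral[OF \<phi>]]) (simp add: \<phi>0_def)
  then obtain \<gamma>1 where \<gamma>1: "gauge \<gamma>1" "\<And>\<D>. \<D> tagged_division_of {a..b} \<Longrightarrow> \<gamma>1 fine \<D> \<Longrightarrow>
       norm ((\<Sum>(x,k)\<in>\<D>. measure lborel k *\<^sub>R \<phi>0 x) - integral {a..b} \<phi>) < e / 3"
    using \<open>e > 0\<close> unfolding has_integral_real by (metis divide_pos_pos zero_less_numeral)
  \<comment> \<open>At a tag in \<open>N\<close> the gauge is all of \<open>U\<close>, so the
    intervals tagged there lie in a set of measure below \<open>\<delta>\<close>. The radius 1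
    outside \<open>{a..b}\<close> only makes \<open>\<gamma>2\<close> a gauge.\<close>
  define \<gamma>2 where "\<gamma>2 = (\<lambda>t. if t \<in> N then U else ball t (if t \<in> {a..b} then d t else 1))"
  have "gauge \<gamma>2"
    using U(1,2) d by (auto simp: gauge_def \<gamma>2_def)
  then obtain \<D> where \<D>: "\<D> tagged_division_of {a..b}" and "(\<lambda>x. \<gamma>1 x \<inter> \<gamma>2 x) fine \<D>"
    using fine_division_exists_real[OF gauge_Int[OF \<gamma>1(1)]] by blast
  then have fine: "\<gamma>1 fine \<D>" "\<gamma>2 fine \<D>" by (auto simp: fine_Int)
  have fin: "finite \<D>" using \<D> by blast
  have box: "K = {Inf K..Sup K} \<and> a \<le> Inf K \<and> Inf K \<le> x \<and> x \<le> Sup K \<and> Sup K \<le> b"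
    if xK: "(x, K) \<in> \<D>" for x K
  proof -
    obtain s u where K: "K = {s..u}" using tagged_division_ofD(4)[OF \<D> xK] by auto
    moreover have "x \<in> K" "K \<subseteq> {a..b}" using tagged_division_ofD(2,3)[OF \<D> xK] by auto
    ultimately show ?thesis by auto
  qed
  define D1 where "D1 = {(x, K) \<in> \<D>. x \<in> N}"
  define D2 where "D2 = {(x, K) \<in> \<D>. x \<notin> N}"
  have D12: "\<D> = D1 \<union> D2" "D1 \<inter> D2 = {}" by (auto simp: D1_def D2_def)
  have fin12: "finite D1" "finite D2" using fin D12 by auto
  have split: "(\<Sum>(x, K)\<in>\<D>. h x K) = (\<Sum>(x, K)\<in>D1. h x K) + (\<Sum>(x, K)\<in>D2. h x K)" for h :: "real \<Rightarrow> real set \<Rightarrow> real"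
    using fin12 D12(2) unfolding D12(1) by (rule sum.union_disjoint)
  have len: "measure lborel K = Sup K - Inf K" if "(x, K) \<in> \<D>" for x K
    using box[OF that] by (metis content_real order_trans)
  let ?p = "\<lambda>(x :: real, K :: real set). (Inf K, Sup K)"
  have disj: "{Inf K<..<Sup K} \<inter> {Inf L<..<Sup L} = {}"
    if "(x, K) \<in> \<D>" "(z, L) \<in> \<D>" "(x, K) \<noteq> (z, L)" for x K z L
    using tagged_division_ofD(5)[OF \<D> that] box[OF that(1)] box[OF that(2)]
    by (metis interior_atLeastAtMost_real)
  \<comment> \<open>Passing from tagged intervals to pairs of end points must not merge summands.
    Two tags sharing an interval would make its interior empty, and a one-point interval determines
    its tag.\<close>
  have inj: "inj_on ?p D1"
  proof (rule inj_onI, clarify)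
    fix x K z L assume *: "(x, K) \<in> D1" "(z, L) \<in> D1" "Inf K = Inf L" "Sup K = Sup L"
    then have in\<D>: "(x, K) \<in> \<D>" "(z, L) \<in> \<D>" by (auto simp: D1_def)
    have "K = L" using box[OF in\<D>(1)] box[OF in\<D>(2)] * by metis
    moreover have "x = z"
    proof (rule ccontr)
      assume "x \<noteq> z"
      then have "{Inf K<..<Sup K} = {}" using disj[OF in\<D>] * by auto
      then have "Inf K = Sup K" using box[OF in\<D>(1)] by (auto simp: not_less)
      then show False using box[OF in\<D>(1)] box[OF in\<D>(2)] * \<open>x \<noteq> z\<close> by auto
    qed
    ultimately show "x = z \<and> K = L" by simp
  qed
  have disjP: "disjoint_family_on (\<lambda>(s, t). {s<..<t}) (?p ` D1)"
    unfolding disjoint_family_on_def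
  proof (intro ballI impI)
    fix p q assume "p \<in> ?p ` D1" "q \<in> ?p ` D1" "p \<noteq> q"
    then obtain x K z L where "(x, K) \<in> D1" "(z, L) \<in> D1" "p = (Inf K, Sup K)" "q = (Inf L, Sup L)"
      by auto
    then show "(case p of (s, t) \<Rightarrow> {s<..<t}) \<inter> (case q of (s, t) \<Rightarrow> {s<..<t}) = {}"
      using disj[of x K z L] \<open>p \<noteq> q\<close> by (auto simp: D1_def)
  qed
  have inU: "{s<..<t} \<subseteq> U" if "(s, t) \<in> ?p ` D1" for s t
  proof -
    obtain x K where xK: "(x, K) \<in> D1" "s = Inf K" "t = Sup K" using \<open>(s, t) \<in> ?p ` D1\<close> by auto
    then have "(x, K) \<in> \<D>" "x \<in> N" by (auto simp: D1_def)
    have "{s<..<t} \<subseteq> {Inf K..Sup K}" using xK by auto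
    also have "\<dots> = K" using box[OF \<open>(x, K) \<in> \<D>\<close>] by simp
    also have "\<dots> \<subseteq> \<gamma>2 x" using fine(2) \<open>(x, K) \<in> \<D>\<close> by (auto simp: fine_def)
    also have "\<dots> = U" using \<open>x \<in> N\<close> by (simp add: \<gamma>2_def)
    finally show ?thesis .
  qed
  \<comment> \<open>The open intervals are disjoint and contained in \<open>U\<close>, so their
    total length is the measure of their union.\<close>
  have sumlen: "(\<Sum>(s, t) \<in> ?p ` D1. t - s) < \<delta>"
  proof -
    have "ennreal (\<Sum>(s, t) \<in> ?p ` D1. t - s) = (\<Sum>(s, t) \<in> ?p ` D1. ennreal (t - s))"
    proof -
      have "0 \<le> (case p of (s, t) \<Rightarrow> t - s)" if "p \<in> ?p ` D1" for p
        using that box by (force simp: D1_def)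
      then have "ennreal (\<Sum>(s, t) \<in> ?p ` D1. t - s) = (\<Sum>p \<in> ?p ` D1. ennreal (case p of (s, t) \<Rightarrow> t - s))"
        by (rule sum_ennreal[symmetric])
      then show ?thesis by (simp add: case_prod_unfold)
    qed
    also have "\<dots> = (\<Sum>p \<in> ?p ` D1. emeasure lebesgue ((\<lambda>(s, t). {s<..<t}) p))"
    proof (rule sum.cong)
      fix p assume "p \<in> ?p ` D1"
      then obtain x K where "(x, K) \<in> \<D>" "p = (Inf K, Sup K)" by (auto simp: D1_def)
      then show "(case p of (s, t) \<Rightarrow> ennreal (t - s)) = emeasure lebesgue ((\<lambda>(s, t). {s<..<t}) p)"
        using box[of x K] by auto
    qed simp
    also have "\<dots> = emeasure lebesgue (\<Union>p \<in> ?p ` D1. (\<lambda>(s, t). {s<..<t}) p)"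
      using fin12(1) disjP by (intro sum_emeasure) auto
    also have "\<dots> \<le> emeasure lebesgue U"
      using inU U(1) by (intro emeasure_mono) (fastforce, auto)
    also have "\<dots> < ennreal \<delta>" by (rule emU)
    finally show ?thesis using \<open>\<delta> > 0\<close> by (simp add: ennreal_less_iff sum_nonneg) (meson ennreal_leI not_le)
  qed
  have "(\<Sum>(x, K)\<in>D1. f (Sup K) - f (Inf K)) \<le> (\<Sum>(x, K)\<in>D1. norm (f (Sup K) - f (Inf K)))"
    by (rule sum_mono) auto
  also have "\<dots> = (\<Sum>(s, t) \<in> ?p ` D1. norm (f t - f s))"
    by (subst sum.reindex[OF inj]) (simp add: case_prod_unfold)
  also have "\<dots> < e / 3"
    by (rule \<delta>[OF _ _ disjP sumlen]) (use fin12(1) box in \<open>auto simp: D1_def, meson order_trans\<close>)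
  finally have S1: "(\<Sum>(x, K)\<in>D1. f (Sup K) - f (Inf K)) < e / 3" .
  have approx: "(\<Sum>(x, K)\<in>\<D>. measure lborel K *\<^sub>R \<phi>0 x) - integral {a..b} \<phi> < e / 3"
    using \<gamma>1(2)[OF \<D> fine(1)] unfolding real_norm_def by linarith
  have "(\<Sum>(x, K)\<in>D2. f (Sup K) - f (Inf K)) \<le> (\<Sum>(x, K)\<in>D2. measure lborel K * \<phi>0 x + \<epsilon> * measure lborel K)"
  proof (rule sum_mono, clarify)
    fix x K assume xK: "(x, K) \<in> D2"
    then have "(x, K) \<in> \<D>" "x \<notin> N" by (auto simp: D2_def)
    note b = box[OF this(1)]
    then have "x \<in> {a..b}" by auto
    have "K \<subseteq> \<gamma>2 x" using fine(2) \<open>(x, K) \<in> \<D>\<close> by (auto simp: fine_def)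
    then have "K \<subseteq> ball x (d x)" using \<open>x \<notin> N\<close> \<open>x \<in> {a..b}\<close> by (simp add: \<gamma>2_def)
    moreover have "Inf K \<in> K" "Sup K \<in> K" using b by (metis atLeastAtMost_iff order_refl order_trans)+
    ultimately have "\<bar>Inf K - x\<bar> < d x" "\<bar>Sup K - x\<bar> < d x" by (auto simp: dist_real_def)
    then have "f (Sup K) - f (Inf K) \<le> (\<phi> x + \<epsilon>) * (Sup K - Inf K)"
      using d_le[of x "Inf K" "Sup K"] b \<open>x \<notin> N\<close> by auto
    then show "f (Sup K) - f (Inf K) \<le> measure lborel K * \<phi>0 x + \<epsilon> * measure lborel K"
      using \<open>x \<notin> N\<close> unfolding len[OF \<open>(x, K) \<in> \<D>\<close>] by (simp add: \<phi>0_def algebra_simps)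
  qed
  \<comment> \<open>On \<open>D1\<close> the function \<open>\<phi>0\<close> vanishes, so the added
    terms are multiples of \<open>\<epsilon>\<close> by lengths, hence nonnegative.\<close>
  also have "\<dots> \<le> (\<Sum>(x, K)\<in>\<D>. measure lborel K * \<phi>0 x + \<epsilon> * measure lborel K)"
  proof -
    have "0 \<le> (\<Sum>(x, K)\<in>D1. measure lborel K * \<phi>0 x + \<epsilon> * measure lborel K)"
      using \<epsilon>(1) by (intro sum_nonneg) (auto simp: D1_def \<phi>0_def)
    then show ?thesis unfolding split by simp
  qed
  also have "\<dots> = (\<Sum>(x, K)\<in>\<D>. measure lborel K *\<^sub>R \<phi>0 x) + \<epsilon> * (\<Sum>(x, K)\<in>\<D>. measure lborel K)"
    by (simp add: case_prod_unfold sum.distrib sum_distrib_left)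
  also have "(\<Sum>(x, K)\<in>\<D>. measure lborel K) = b - a"
    using additive_content_tagged_division[of \<D> a b] \<D> ab by simp
  finally have S2: "(\<Sum>(x, K)\<in>D2. f (Sup K) - f (Inf K)) \<le> integral {a..b} \<phi> + e / 3 + e / 3"
    using approx \<epsilon>(2) by linarith
  have "f b - f a = (\<Sum>(x, K)\<in>\<D>. f (Sup K) - f (Inf K))"
    using additive_tagged_division_1[OF ab \<D>, of f] by simp
  then show "f b - f a \<le> integral {a..b} \<phi> + e"
    using S1 S2 unfolding split by simp
qed

section \<open>Closure properties of absolute continuity\<close>

text \<open>Summing the increment bound over a family of intervals transfers smallness from
  \<open>u\<close> and \<open>v\<close> to \<open>f\<close>. Sums, products and Lipschitz functions
  are all obtained from this criterion.\<close>

lemma abs_continuous_on_interval_dominated: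
  assumes u: "abs_continuous_on_interval a b u" and v: "abs_continuous_on_interval a b v"
    and L: "\<And>s t. a \<le> s \<Longrightarrow> s \<le> t \<Longrightarrow> t \<le> b \<Longrightarrow>
      norm (f t - f s) \<le> L * (norm (u t - u s) + norm (v t - v s))"
  shows "abs_continuous_on_interval a b f"
  unfolding abs_continuous_on_interval_def
proof (intro allI impI)
  fix e :: real assume "e > 0"
  define L' where "L' = \<bar>L\<bar> + 1"
  have "L' > 0" by (simp add: L'_def)
  then have "e / (2 * L') > 0" using \<open>e > 0\<close> by simp
  obtain d1 where d1: "d1 > 0" "\<And>P. finite P \<and> (\<forall>(s, t) \<in> P. a \<le> s \<and> s \<le> t \<and> t \<le> b) \<and>
        disjoint_family_on (\<lambda>(s, t). {s<..<t}) P \<and>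
        (\<Sum>(s, t) \<in> P. t - s) < d1 \<Longrightarrow> (\<Sum>(s, t) \<in> P. norm (u t - u s)) < e / (2 * L')"
    using u[unfolded abs_continuous_on_interval_def, rule_format, OF \<open>e / (2 * L') > 0\<close>] by blast
  obtain d2 where d2: "d2 > 0" "\<And>P. finite P \<and> (\<forall>(s, t) \<in> P. a \<le> s \<and> s \<le> t \<and> t \<le> b) \<and>
        disjoint_family_on (\<lambda>(s, t). {s<..<t}) P \<and>
        (\<Sum>(s, t) \<in> P. t - s) < d2 \<Longrightarrow> (\<Sum>(s, t) \<in> P. norm (v t - v s)) < e / (2 * L')"
    using v[unfolded abs_continuous_on_interval_def, rule_format, OF \<open>e / (2 * L') > 0\<close>] by blast
  show "\<exists>\<delta>>0. \<forall>P. finite P \<and> (\<forall>(s, t)\<in>P. a \<le> s \<and> s \<le> t \<and> t \<le> b) \<and>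
      disjoint_family_on (\<lambda>(s, t). {s<..<t}) P \<and> (\<Sum>(s, t)\<in>P. t - s) < \<delta> \<longrightarrow>
      (\<Sum>(s, t)\<in>P. norm (f t - f s)) < e"
  proof (intro exI[of _ "min d1 d2"] conjI allI impI)
    show "min d1 d2 > 0" using d1(1) d2(1) by simp
    fix P assume P: "finite P \<and> (\<forall>(s, t)\<in>P. a \<le> s \<and> s \<le> t \<and> t \<le> b) \<and>
      disjoint_family_on (\<lambda>(s, t). {s<..<t}) P \<and> (\<Sum>(s, t)\<in>P. t - s) < min d1 d2"
    have "(\<Sum>(s, t)\<in>P. norm (f t - f s)) \<le> (\<Sum>(s, t)\<in>P. L' * (norm (u t - u s) + norm (v t - v s)))"
    proof (rule sum_mono, clarify)
      fix s t assume "(s, t) \<in> P"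
      then have "norm (f t - f s) \<le> L * (norm (u t - u s) + norm (v t - v s))" using L P by auto
      also have "\<dots> \<le> L' * (norm (u t - u s) + norm (v t - v s))"
        by (rule mult_right_mono) (auto simp: L'_def)
      finally show "norm (f t - f s) \<le> L' * (norm (u t - u s) + norm (v t - v s))" .
    qed
    also have "\<dots> = L' * ((\<Sum>(s, t) \<in> P. norm (u t - u s)) + (\<Sum>(s, t) \<in> P. norm (v t - v s)))"
      by (simp add: case_prod_unfold sum.distrib sum_distrib_left distrib_left)
    also have "\<dots> < L' * (e / (2 * L') + e / (2 * L'))"
      using d1(2)[of P] d2(2)[of P] P by (intro mult_strict_left_mono add_strict_mono) (auto simp: L'_def)
    also have "\<dots> = e" using \<open>L' > 0\<close> by (simp add: field_simps)
    finally show "(\<Sum>(s, t)\<in>P. norm (f t - f s)) < e" .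
  qed
qed

lemma abs_continuous_on_interval_subset:
  assumes "abs_continuous_on_interval a b f" "a \<le> c" "d \<le> b"
  shows "abs_continuous_on_interval c d f"
  unfolding abs_continuous_on_interval_def
proof (intro allI impI)
  fix e :: real assume "e > 0"
  obtain \<delta> where "\<delta> > 0" and \<delta>: "\<forall>P. finite P \<and> (\<forall>(s, t) \<in> P. a \<le> s \<and> s \<le> t \<and> t \<le> b) \<and>
        disjoint_family_on (\<lambda>(s, t). {s<..<t}) P \<and>
        (\<Sum>(s, t) \<in> P. t - s) < \<delta> \<longrightarrow> (\<Sum>(s, t) \<in> P. norm (f t - f s)) < e"
    using assms(1)[unfolded abs_continuous_on_interval_def, rule_format, OF \<open>e > 0\<close>] by (elim exE conjE)
  show "\<exists>\<delta>>0. \<forall>P. finite P \<and> (\<forall>(s, t)\<in>P. c \<le> s \<and> s \<le> t \<and> t \<le> d) \<and>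
      disjoint_family_on (\<lambda>(s, t). {s<..<t}) P \<and> (\<Sum>(s, t)\<in>P. t - s) < \<delta> \<longrightarrow>
      (\<Sum>(s, t)\<in>P. norm (f t - f s)) < e"
  proof (intro exI[of _ \<delta>] conjI allI impI \<open>\<delta> > 0\<close>)
    fix P assume P: "finite P \<and> (\<forall>(s, t)\<in>P. c \<le> s \<and> s \<le> t \<and> t \<le> d) \<and>
      disjoint_family_on (\<lambda>(s, t). {s<..<t}) P \<and> (\<Sum>(s, t)\<in>P. t - s) < \<delta>"
    then have "\<forall>(s, t)\<in>P. a \<le> s \<and> s \<le> t \<and> t \<le> b"
      using assms(2,3) by (auto intro: order_trans)
    with P show "(\<Sum>(s, t)\<in>P. norm (f t - f s)) < e" using \<delta> by simp
  qed
qed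

lemma abs_continuous_on_interval_id: "abs_continuous_on_interval a b (\<lambda>t::real. t)"
  unfolding abs_continuous_on_interval_def
proof (intro allI impI)
  fix e :: real assume "e > 0"
  have "(\<Sum>(s, t)\<in>P. norm (t - s)) = (\<Sum>(s, t)\<in>P. t - s)"
    if "\<forall>(s, t)\<in>P. a \<le> s \<and> s \<le> t \<and> t \<le> b" for P :: "(real \<times> real) set"
    using that by (intro sum.cong) auto
  then show "\<exists>\<delta>>0. \<forall>P. finite P \<and> (\<forall>(s, t)\<in>P. a \<le> s \<and> s \<le> t \<and> t \<le> b) \<and>
      disjoint_family_on (\<lambda>(s, t). {s<..<t}) P \<and> (\<Sum>(s, t)\<in>P. t - s) < \<delta> \<longrightarrow>
      (\<Sum>(s, t)\<in>P. norm (t - s)) < e"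
    using \<open>e > 0\<close> by (intro exI[of _ e]) auto
qed

text \<open>Absolute continuity is applied to families consisting of a single interval.\<close>

lemma abs_continuous_on_interval_imp_continuous_on:
  assumes "abs_continuous_on_interval a b f"
  shows "continuous_on {a..b} f"
  unfolding continuous_on_iff
proof (intro ballI allI impI)
  fix t e :: real assume t: "t \<in> {a..b}" and "e > 0"
  then obtain d where d: "d > 0" "\<And>P. finite P \<and> (\<forall>(s, t) \<in> P. a \<le> s \<and> s \<le> t \<and> t \<le> b) \<and>
        disjoint_family_on (\<lambda>(s, t). {s<..<t}) P \<and>
        (\<Sum>(s, t) \<in> P. t - s) < d \<Longrightarrow> (\<Sum>(s, t) \<in> P. norm (f t - f s)) < e"
    using assms unfolding abs_continuous_on_interval_def by blast
  have close: "norm (f u - f s) < e" if "a \<le> s" "s \<le> u" "u \<le> b" "u - s < d" for s u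
    using d(2)[of "{(s, u)}"] that by (auto simp: disjoint_family_on_def)
  have "dist (f u) (f t) < e" if u: "u \<in> {a..b}" "dist u t < d" for u
  proof (cases "u \<le> t")
    case True
    then have "norm (f t - f u) < e" using u t by (intro close) (auto simp: dist_real_def)
    then show ?thesis by (simp add: dist_norm norm_minus_commute)
  next
    case False
    then have "norm (f u - f t) < e" using u t by (intro close) (auto simp: dist_real_def)
    then show ?thesis by (simp add: dist_norm)
  qed
  then show "\<exists>d>0. \<forall>x'\<in>{a..b}. dist x' t < d \<longrightarrow> dist (f x') (f t) < e"
    using d(1) by blast
qed

lemma abs_continuous_on_interval_bounded:
  assumes "abs_continuous_on_interval a b f"
  obtains B where "B > 0" "\<And>t. t \<in> {a..b} \<Longrightarrow> norm (f t) \<le> B"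
proof -
  have "bounded (f ` {a..b})"
    using abs_continuous_on_interval_imp_continuous_on[OF assms]
    by (intro compact_imp_bounded compact_continuous_image) auto
  then show thesis using that unfolding bounded_pos by auto
qed

lemma abs_continuous_on_interval_add:
  assumes "abs_continuous_on_interval a b f" "abs_continuous_on_interval a b g"
  shows "abs_continuous_on_interval a b (\<lambda>t. f t + g t)"
proof (rule abs_continuous_on_interval_dominated[OF assms, of _ 1])
  fix s t
  have eq: "f t + g t - (f s + g s) = (f t - f s) + (g t - g s)" by simp
  show "norm (f t + g t - (f s + g s)) \<le> 1 * (norm (f t - f s) + norm (g t - g s))"
    unfolding eq mult_1 by (rule norm_triangle_ineq)
qed

lemma abs_continuous_on_interval_const: "abs_continuous_on_interval a b (\<lambda>t. c)"
  by (rule abs_continuous_on_interval_dominated[OF abs_continuous_on_interval_id abs_continuous_on_interval_id, of _ _ _ 1]) simp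

lemma (in bounded_bilinear) abs_continuous_on_interval_prod:
  assumes f: "abs_continuous_on_interval a b f" and g: "abs_continuous_on_interval a b g"
  shows "abs_continuous_on_interval a b (\<lambda>t. prod (f t) (g t))"
proof -
  obtain B where B: "B > 0" "\<And>t. t \<in> {a..b} \<Longrightarrow> norm (f t) \<le> B"
    using abs_continuous_on_interval_bounded[OF f] by blast
  obtain C where C: "C > 0" "\<And>t. t \<in> {a..b} \<Longrightarrow> norm (g t) \<le> C"
    using abs_continuous_on_interval_bounded[OF g] by blast
  obtain K where K: "K > 0" "\<And>x y. norm (prod x y) \<le> norm x * norm y * K"
    using pos_bounded by blast
  show ?thesis
  proof (rule abs_continuous_on_interval_dominated[OF f g, of _ "(B + C) * K"])
    fix s t assume st: "a \<le> s" "s \<le> t" "t \<le> b"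
    have "prod (f t) (g t) - prod (f s) (g s) = prod (f t - f s) (g t) + prod (f s) (g t - g s)"
      by (simp add: diff_left diff_right)
    then have "norm (prod (f t) (g t) - prod (f s) (g s))
        \<le> norm (f t - f s) * norm (g t) * K + norm (f s) * norm (g t - g s) * K"
      using norm_triangle_le K(2) add_mono by metis
    also have "\<dots> \<le> norm (f t - f s) * (B + C) * K + (B + C) * norm (g t - g s) * K"
      using B(1) B(2)[of s] C(1) C(2)[of t] K(1) st
      by (intro add_mono mult_right_mono mult_left_mono) auto
    also have "\<dots> = (B + C) * K * (norm (f t - f s) + norm (g t - g s))"
      by (simp add: algebra_simps)
    finally show "norm (prod (f t) (g t) - prod (f s) (g s))
      \<le> (B + C) * K * (norm (f t - f s) + norm (g t - g s))" .
  qed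
qed

text \<open>The mean value inequality makes \<open>f\<close> Lipschitz, so its increments are
  dominated by those of the identity.\<close>

lemma abs_continuous_on_interval_bounded_derivative:
  fixes f :: "real \<Rightarrow> 'a::real_normed_vector"
  assumes der: "\<And>t. t \<in> {a..b} \<Longrightarrow> (f has_vector_derivative f' t) (at t within {a..b})"
    and bd: "\<And>t. t \<in> {a..b} \<Longrightarrow> norm (f' t) \<le> B"
  shows "abs_continuous_on_interval a b f"
proof (rule abs_continuous_on_interval_dominated[OF abs_continuous_on_interval_id abs_continuous_on_interval_id, of _ _ _ B])
  fix s t assume st: "a \<le> s" "s \<le> t" "t \<le> b"
  then have "0 \<le> B" by (intro order_trans[OF norm_ge_zero bd[of s]]) auto
  have "norm (f t - f s) \<le> B * norm (t - s)"
  proof (rule differentiable_bound[where S = "{a..b}" and f = f and f' = "\<lambda>t h. h *\<^sub>R f' t"])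
    show "convex {a..b}" by simp
    show "(f has_derivative (\<lambda>h. h *\<^sub>R f' t)) (at t within {a..b})" if "t \<in> {a..b}" for t
      using der[OF that] by (simp add: has_vector_derivative_def)
    show "onorm (\<lambda>h. h *\<^sub>R f' t) \<le> B" if "t \<in> {a..b}" for t
      using bd[OF that] by (intro onorm_le) (simp add: mult.commute[of B] mult_left_mono)
  qed (use st in auto)
  also have "\<dots> \<le> B * (norm (t - s) + norm (t - s))" using \<open>0 \<le> B\<close> by (intro mult_left_mono) auto
  finally show "norm (f t - f s) \<le> B * (norm (t - s) + norm (t - s))" .
qed

section \<open>Convex functions and elementary inequalities\<close>

text \<open>By convexity the difference quotients along the segment from \<open>x\<close> to
  \<open>y\<close> are at most \<open>F y - F x\<close>; the bound survives the limit at the left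
  end.\<close>

lemma convex_GDERIV_le:
  fixes F :: "'a::real_inner \<Rightarrow> real"
  assumes F: "convex_on UNIV F" and d: "GDERIV F x :> d"
  shows "d \<bullet> (y - x) \<le> F y - F x"
proof -
  let ?\<phi> = "\<lambda>s. F (x + s *\<^sub>R (y - x))"
  have 1: "((\<lambda>s. x + s *\<^sub>R (y - x)) has_derivative (\<lambda>h. h *\<^sub>R (y - x))) (at 0)"
    by (auto intro!: derivative_eq_intros)
  have 2: "(F has_derivative (\<lambda>h. h \<bullet> d)) (at (x + 0 *\<^sub>R (y - x)))"
    using d by (simp add: gderiv_def)
  have 3: "(\<lambda>h. (h *\<^sub>R (y - x)) \<bullet> d) = (*) (d \<bullet> (y - x))"
    by (simp add: fun_eq_iff inner_commute)
  have "(?\<phi> has_real_derivative d \<bullet> (y - x)) (at 0)"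
    using has_derivative_compose[OF 1 2] unfolding has_field_derivative_def 3 .
  then have lim: "((\<lambda>s. (?\<phi> s - F x) / s) \<longlongrightarrow> d \<bullet> (y - x)) (at_right 0)"
    by (intro tendsto_mono[OF at_le[of "{0<..}" UNIV]]) (simp_all add: has_field_derivative_iff)
  have "eventually (\<lambda>s. (?\<phi> s - F x) / s \<le> F y - F x) (at_right (0::real))"
    unfolding eventually_at_right_field
  proof (intro exI[of _ 1] conjI allI impI)
    fix s :: real assume s: "0 < s" "s < 1"
    have "F ((1 - s) *\<^sub>R x + s *\<^sub>R y) \<le> (1 - s) * F x + s * F y"
      using F s by (auto simp: convex_on_def)
    then have "?\<phi> s - F x \<le> (F y - F x) * s"
      by (simp add: algebra_simps)
    then show "(?\<phi> s - F x) / s \<le> F y - F x"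
      using s by (simp only: pos_divide_le_eq)
  qed simp
  with lim show ?thesis by (intro tendsto_upperbound) auto
qed

text \<open>Strict positivity on a sphere propagates outwards linearly by convexity.\<close>

lemma convex_unique_minimizer_growth:
  fixes F :: "'a::euclidean_space \<Rightarrow> real"
  assumes F: "convex_on UNIV F" and cont: "continuous_on UNIV F"
    and strict: "\<And>z. z \<noteq> a \<Longrightarrow> F a < F z" and "\<epsilon> > 0"
  obtains m where "m > 0" "\<And>z. \<epsilon> \<le> norm (z - a) \<Longrightarrow> m * norm (z - a) \<le> F z - F a"
proof -
  have "sphere a \<epsilon> \<noteq> {}" using \<open>\<epsilon> > 0\<close> by simp
  then obtain p where p: "p \<in> sphere a \<epsilon>" "\<And>z. z \<in> sphere a \<epsilon> \<Longrightarrow> F p \<le> F z"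
    using continuous_attains_inf[OF compact_sphere _ continuous_on_subset[OF cont]] by (metis subset_UNIV)
  have "p \<noteq> a" using p(1) \<open>\<epsilon> > 0\<close> by auto
  then have "F a < F p" by (rule strict)
  show thesis
  proof (rule that[of "(F p - F a) / \<epsilon>"])
    show "(F p - F a) / \<epsilon> > 0" using \<open>F a < F p\<close> \<open>\<epsilon> > 0\<close> by simp
    fix z assume z: "\<epsilon> \<le> norm (z - a)"
    define s where "s = \<epsilon> / norm (z - a)"
    have nz: "norm (z - a) > 0" using z \<open>\<epsilon> > 0\<close> by linarith
    have s: "0 < s" "s \<le> 1" using z \<open>\<epsilon> > 0\<close> nz by (auto simp: s_def)
    \<comment> \<open>This is where the segment from \<open>a\<close> to \<open>z\<close> crosses
      the sphere; convexity on that segment compares \<open>F z\<close> with the minimum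
      \<open>F p\<close> over the sphere.\<close>
    have "a + s *\<^sub>R (z - a) \<in> sphere a \<epsilon>"
      using nz \<open>\<epsilon> > 0\<close> by (simp add: dist_norm s_def)
    then have "F p \<le> F (a + s *\<^sub>R (z - a))" by (rule p(2))
    also have "\<dots> = F ((1 - s) *\<^sub>R a + s *\<^sub>R z)" by (simp add: algebra_simps)
    also have "\<dots> \<le> (1 - s) * F a + s * F z" using F s by (auto simp: convex_on_def)
    finally have "F p - F a \<le> s * (F z - F a)" by (simp add: algebra_simps)
    then show "(F p - F a) / \<epsilon> * norm (z - a) \<le> F z - F a"
      using nz \<open>\<epsilon> > 0\<close> by (simp add: s_def field_simps)
  qed
qed

section \<open>Absorption inequalities\<close>

text \<open>A substitute for a Gronwall argument: at a point \<open>s\<close> where \<open>z\<close>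
  is maximal on \<open>{T..t}\<close>, \<open>Z = z s\<close> is admissible, and
  \<open>(z s)\<^sup>2 \<le> C0 + C1 * z s\<close> bounds \<open>z s\<close> independently of
  \<open>t\<close>.\<close>

lemma bounded_of_square_le_running_maximum:
  fixes z :: "real \<Rightarrow> real"
  assumes cont: "\<And>t. continuous_on {T..t} z" and "C0 \<ge> 0" "C1 \<ge> 0"
    and le: "\<And>t Z. T \<le> t \<Longrightarrow> (\<And>s. s \<in> {T..t} \<Longrightarrow> z s \<le> Z) \<Longrightarrow> Z \<ge> 0 \<Longrightarrow> (z t)\<^sup>2 \<le> C0 + C1 * Z"
  shows "\<exists>B\<ge>0. \<forall>t\<ge>T. z t \<le> B"
proof (intro exI[of _ "max 1 (C0 + C1)"] conjI allI impI)
  fix t assume "t \<ge> T"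
  then have "\<exists>s\<in>{T..t}. \<forall>u\<in>{T..t}. z u \<le> z s"
    by (intro continuous_attains_sup cont) auto
  then obtain s where s: "s \<in> {T..t}" "\<And>u. u \<in> {T..t} \<Longrightarrow> z u \<le> z s" by blast
  have "z s \<le> max 1 (C0 + C1)"
  proof (cases "z s \<le> 1")
    case False
    have "(z s)\<^sup>2 \<le> C0 + C1 * z s" using s False by (intro le) auto
    also have "\<dots> \<le> C0 * z s + C1 * z s" using False \<open>C0 \<ge> 0\<close> by (simp add: mult_le_cancel_left1)
    finally show ?thesis using False by (simp add: power2_eq_square flip: distrib_right)
  qed simp
  then show "z t \<le> max 1 (C0 + C1)" using s(2)[of t] \<open>t \<ge> T\<close> by auto
qed simp

text \<open>A power below one is eventually dominated by any linear function. The threshold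
  \<open>X0\<close> solves \<open>D * X powr p = X / 2\<close>; below it monotonicity gives a
  constant bound.\<close>

lemma powr_le_linear_plus_const:
  fixes p D :: real
  assumes "p < 1" "D \<ge> 0" "p > 0"
  obtains C where "\<And>X. X \<ge> 0 \<Longrightarrow> D * X powr p \<le> X / 2 + C" "C \<ge> 0"
proof -
  define X0 where "X0 = (2 * D) powr (1 / (1 - p))"
  show thesis
  proof (rule that[of "D * X0 powr p"])
    fix X :: real assume "X \<ge> 0"
    show "D * X powr p \<le> X / 2 + D * X0 powr p"
    proof (cases "X \<le> X0")
      case True
      then have "D * X powr p \<le> D * X0 powr p"
        using assms \<open>X \<ge> 0\<close> by (intro mult_left_mono powr_mono2) auto
      then show ?thesis using \<open>X \<ge> 0\<close> by linarith
    next
      case False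
      then have "X > 0" using powr_ge_zero[of "2 * D" "1 / (1 - p)"] unfolding X0_def by linarith
      have "2 * D = X0 powr (1 - p)"
        using assms by (simp add: X0_def powr_powr)
      also have "\<dots> \<le> X powr (1 - p)"
        using assms False by (intro powr_mono2) (auto simp: X0_def)
      finally have "D * X powr p \<le> X powr (1 - p) * X powr p / 2"
        using mult_right_mono[OF _ powr_ge_zero, of "2 * D" "X powr (1 - p)" X p] by simp
      also have "\<dots> = X / 2" using \<open>X > 0\<close> by (simp flip: powr_add)
      finally show ?thesis using assms by (simp add: add_increasing2)
    qed
  qed (use assms in auto)
qed

lemma has_real_derivative_inner_self:
  assumes "(u has_vector_derivative u') (at t within A)"
  shows "((\<lambda>t. u t \<bullet> u t) has_real_derivative 2 * (u t \<bullet> u')) (at t within A)"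
  using has_derivative_inner[OF assms[unfolded has_vector_derivative_def] assms[unfolded has_vector_derivative_def]]
  unfolding has_field_derivative_def
  by (rule has_derivative_eq_rhs) (simp add: fun_eq_iff inner_commute algebra_simps)

text \<open>Substituting \<open>v = w - m *\<^sub>R y\<close> makes the products of \<open>w\<close>
  with \<open>y\<close> cancel. With \<open>m = l / t\<close>, \<open>\<tau> = 1 / t\<close> and
  \<open>b = \<alpha> / t powr \<theta>\<close> the coefficient of \<open>y \<bullet> v\<close>
  becomes \<open>xi l t\<close>.\<close>

lemma damped_energy_identity:
  fixes d y v g :: "'a::real_inner" and m \<tau> b :: real
  assumes w: "w = m *\<^sub>R y + v"
  shows "d \<bullet> v + w \<bullet> (- (m * \<tau>) *\<^sub>R y + m *\<^sub>R v + (g - b *\<^sub>R v - d)) + (m\<^sup>2 + m * \<tau> - m * b) * (y \<bullet> v)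
    = - m * (d \<bullet> y) + (m - b) * (w \<bullet> w) - (m\<^sup>2 + m * \<tau> - m * b) * m * (y \<bullet> y) + w \<bullet> g"
  unfolding w
  by (simp add: inner_add_left inner_add_right inner_diff_left inner_diff_right inner_commute
      algebra_simps power2_eq_square)

section \<open>The energy along a trajectory\<close>

text \<open>Only global information is collected here; the two local conditions enter in
  \<open>gap_decay\<close>. Boundedness and convergence of the values are proved for every weight
  exponent \<open>k\<close> of at least 1/2, which \<open>gap_decay\<close> then
  specializes.\<close>

locale damped_trajectory =
  fixes F :: "'a::euclidean_space \<Rightarrow> real" and dF :: "'a \<Rightarrow> 'a" and g x v :: "real \<Rightarrow> 'a"
    and \<alpha> \<theta> t0 k :: real and xs :: 'a
  assumes convex: "convex_on UNIV F"
    and grad: "\<And>z. GDERIV F z :> dF z"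
    and strict_min: "\<And>z. z \<noteq> xs \<Longrightarrow> F xs < F z"
    and \<alpha>_pos: "\<alpha> > 0" and \<theta>: "0 \<le> \<theta>" "\<theta> \<le> 1" and t0_pos: "t0 > 0"
    and x_deriv: "\<And>t. t0 \<le> t \<Longrightarrow> (x has_vector_derivative v t) (at t within {t0..})"
    and v_ac: "\<And>T. t0 \<le> T \<Longrightarrow> abs_continuous_on_interval t0 T v"
    and ode: "AE t in lebesgue. t0 \<le> t \<longrightarrow> (\<exists>a. (v has_vector_derivative a) (at t within {t0..}) \<and>
      a + (\<alpha> / t powr \<theta>) *\<^sub>R v t + dF (x t) = g t)"
    and k: "1 / 2 \<le> k"
    and g_int: "(\<lambda>t. t powr k * norm (g t)) integrable_on {t0..}"
begin

definition w :: "real \<Rightarrow> real \<Rightarrow> 'a" where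
  "w l t = (l / t) *\<^sub>R (x t - xs) + v t"

text \<open>The value of \<open>xi\<close> for which the cross term \<open>w \<bullet> y\<close> disappears from the derivative of the energy.\<close>

definition xi :: "real \<Rightarrow> real \<Rightarrow> real" where
  "xi l t = l * (l + 1) / t\<^sup>2 - l * \<alpha> / t powr (1 + \<theta>)"

definition energy :: "real \<Rightarrow> real \<Rightarrow> real" where
  "energy l t = F (x t) - F xs + (w l t \<bullet> w l t) / 2 + xi l t * ((x t - xs) \<bullet> (x t - xs)) / 2"

text \<open>The coefficient \<open>(xi' + (c - 2 l) xi / t) / 2\<close> of \<open>norm (x - xs) ^ 2\<close> in that derivative.\<close>

definition rest_coeff :: "real \<Rightarrow> real \<Rightarrow> real \<Rightarrow> real" where
  "rest_coeff c l t = l * (l + 1) * (c / 2 - l - 1) / t ^ 3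
    - l * \<alpha> * (c / 2 - l - (1 + \<theta>) / 2) / t powr (2 + \<theta>)"

lemma gap_nonneg: "0 \<le> F z - F xs"
  using strict_min[of z] by (cases "z = xs") auto

lemma continuous_F: "continuous_on A F"
  using grad unfolding gderiv_def
  by (meson continuous_at_imp_continuous_on has_derivative_continuous)

lemma xi_deriv:
  assumes "t > 0"
  shows "(xi l has_real_derivative
    - 2 * l * (l + 1) / t ^ 3 + l * \<alpha> * (1 + \<theta>) / t powr (2 + \<theta>)) (at t within A)"
proof -
  have 1: "((\<lambda>t. l * (l + 1) / t\<^sup>2) has_real_derivative - 2 * l * (l + 1) / t ^ 3) (at t within A)"
    using assms by (auto intro!: derivative_eq_intros simp: power2_eq_square power3_eq_cube field_simps)
  have "((\<lambda>t. t powr (- (1 + \<theta>))) has_real_derivative - (1 + \<theta>) * t powr (- (1 + \<theta>) - 1)) (at t within A)"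
    by (rule has_real_derivative_powr[THEN DERIV_subset]) (use assms in auto)
  from DERIV_cmult[OF this, of "l * \<alpha>"]
  have 2: "((\<lambda>t. l * \<alpha> / t powr (1 + \<theta>)) has_real_derivative
      l * \<alpha> * (- (1 + \<theta>) * t powr (- (1 + \<theta>) - 1))) (at t within A)"
    by (simp only: powr_minus divide_inverse)
  have "- (1 + \<theta>) - 1 = - (2 + \<theta>)" by simp
  then have 3: "t powr (- (1 + \<theta>) - 1) = 1 / t powr (2 + \<theta>)"
    by (simp only: powr_minus divide_inverse mult_1)
  show ?thesis
    unfolding xi_def[abs_def] by (rule DERIV_cong[OF DERIV_diff[OF 1 2]]) (simp only: 3, simp add: algebra_simps add_divide_distrib diff_divide_distrib)
qed

lemma F_deriv:
  assumes "t0 \<le> t"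
  shows "((\<lambda>t. F (x t)) has_real_derivative dF (x t) \<bullet> v t) (at t within {t0..})"
proof -
  have "((\<lambda>t. F (x t)) has_derivative (\<lambda>h. (h *\<^sub>R v t) \<bullet> dF (x t))) (at t within {t0..})"
    by (rule has_derivative_compose) (use x_deriv[OF assms] grad in \<open>simp_all add: has_vector_derivative_def gderiv_def\<close>)
  then show ?thesis
    unfolding has_field_derivative_def
    by (rule has_derivative_eq_rhs) (simp add: fun_eq_iff inner_commute)
qed

text \<open>Valid at the times where \<open>v\<close> is differentiable and the equation holds. The
  terms come from \<open>damped_energy_identity\<close>; differentiating the weight adds
  \<open>c / t\<close> times the energy, which explains the shifts by \<open>c / 2\<close>.\<close>

lemma energy_deriv:
  assumes t: "t0 \<le> t" and v: "(v has_vector_derivative a) (at t within {t0..})"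
    and a: "a + (\<alpha> / t powr \<theta>) *\<^sub>R v t + dF (x t) = g t"
  shows "((\<lambda>t. t powr c * energy l t) has_real_derivative t powr c *
     (c / t * (F (x t) - F xs) - l / t * (dF (x t) \<bullet> (x t - xs))
      + ((c / 2 + l) / t - \<alpha> / t powr \<theta>) * (norm (w l t))\<^sup>2
      + rest_coeff c l t * (norm (x t - xs))\<^sup>2 + w l t \<bullet> g t)) (at t within {t0..})"
proof -
  have "t > 0" using t t0_pos by simp
  define y where "y = x t - xs"
  define b where "b = \<alpha> / t powr \<theta>"
  define xi' where "xi' = - 2 * l * (l + 1) / t ^ 3 + l * \<alpha> * (1 + \<theta>) / t powr (2 + \<theta>)"
  have Fx: "((\<lambda>t. F (x t)) has_real_derivative dF (x t) \<bullet> v t) (at t within {t0..})"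
    by (rule F_deriv[OF t])
  have dy: "((\<lambda>t. x t - xs) has_vector_derivative v t) (at t within {t0..})"
    using has_vector_derivative_diff[OF x_deriv[OF t] has_vector_derivative_const[of xs]] by simp
  have dw: "(w l has_vector_derivative - (l / t * (1 / t)) *\<^sub>R y + (l / t) *\<^sub>R v t + a) (at t within {t0..})"
  proof -
    have "((\<lambda>t. l / t) has_real_derivative - (l / t * (1 / t))) (at t within {t0..})"
      using \<open>t > 0\<close> by (auto intro!: derivative_eq_intros)
    from has_vector_derivative_add[OF has_vector_derivative_scaleR[OF this dy] v]
    show ?thesis unfolding w_def[abs_def] by (simp add: y_def add.commute)
  qed
  have ww: "((\<lambda>t. w l t \<bullet> w l t) has_real_derivative
      2 * (w l t \<bullet> (- (l / t * (1 / t)) *\<^sub>R y + (l / t) *\<^sub>R v t + a))) (at t within {t0..})"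
    by (rule has_real_derivative_inner_self) (rule dw)
  have yy: "((\<lambda>t. (x t - xs) \<bullet> (x t - xs)) has_real_derivative 2 * (y \<bullet> v t)) (at t within {t0..})"
    unfolding y_def by (rule has_real_derivative_inner_self) (rule dy)
  have xi: "(xi l has_real_derivative xi') (at t within {t0..})"
    unfolding xi'_def by (rule xi_deriv) fact
  have E: "(energy l has_real_derivative dF (x t) \<bullet> v t
      + w l t \<bullet> (- (l / t * (1 / t)) *\<^sub>R y + (l / t) *\<^sub>R v t + a)
      + xi l t * (y \<bullet> v t) + xi' * (y \<bullet> y) / 2) (at t within {t0..})"
    unfolding energy_def[abs_def]
    by (rule DERIV_cong[OF DERIV_add[OF DERIV_add[OF DERIV_diff[OF Fx DERIV_const]
          DERIV_cdivide[OF ww, of 2]] DERIV_cdivide[OF DERIV_mult[OF xi yy], of 2]]])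
      (simp add: y_def field_simps)
  have xi_eq: "xi l t = (l / t)\<^sup>2 + l / t * (1 / t) - l / t * b"
    using \<open>t > 0\<close> by (simp add: xi_def b_def powr_add power2_eq_square field_simps)
  have a': "a = g t - b *\<^sub>R v t - dF (x t)" using a by (simp add: b_def algebra_simps)
  have "w l t = (l / t) *\<^sub>R y + v t" by (simp add: w_def y_def)
  note damped_energy_identity[OF this, of "dF (x t)" "1 / t" "g t" b]
  then have E': "(energy l has_real_derivative
      - (l / t) * (dF (x t) \<bullet> y) + (l / t - b) * (w l t \<bullet> w l t) - xi l t * (l / t) * (y \<bullet> y)
      + w l t \<bullet> g t + xi' * (y \<bullet> y) / 2) (at t within {t0..})"
    using E unfolding a' xi_eq by simp
  have pow: "((\<lambda>t. t powr c) has_real_derivative t powr c * (c / t)) (at t within {t0..})"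
    using has_real_derivative_powr[OF \<open>t > 0\<close>, of c, THEN DERIV_subset, of "{t0..}"] \<open>t > 0\<close>
    by (simp add: powr_diff mult.commute)
  have rest: "rest_coeff c l t = xi' / 2 + xi l t * (c / 2 - l) / t"
    using \<open>t > 0\<close>
    by (simp add: rest_coeff_def xi'_def xi_def powr_add power2_eq_square power3_eq_cube field_simps)
  show ?thesis
    by (rule DERIV_cong[OF DERIV_mult[OF pow E']])
      (simp add: energy_def rest y_def b_def power2_norm_eq_inner algebra_simps add_divide_distrib diff_divide_distrib)
qed

section \<open>Regularity of the energy and its integrated inequality\<close>

lemma continuous_x: "continuous_on {t0..} x"
  by (auto simp: continuous_on_eq_continuous_within intro: has_vector_derivative_continuous[OF x_deriv])

lemma continuous_v: "continuous_on {t0..T} v"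
proof (cases "t0 \<le> T")
  case True
  then show ?thesis by (intro abs_continuous_on_interval_imp_continuous_on v_ac)
qed simp

text \<open>A step of length at most one in the direction of the gradient raises the convex function
  \<open>F\<close> by at least the norm of the gradient, and \<open>F\<close> is bounded on a
  slightly larger ball.\<close>

lemma dF_bounded:
  assumes "bounded S"
  obtains B where "\<And>z. z \<in> S \<Longrightarrow> norm (dF z) \<le> B"
proof -
  obtain R where R: "\<And>z. z \<in> S \<Longrightarrow> norm z \<le> R" using assms unfolding bounded_iff by blast
  have "bounded (F ` cball 0 (R + 1))"
    by (intro compact_imp_bounded compact_continuous_image continuous_F) simp
  then obtain C where C: "\<And>z. norm z \<le> R + 1 \<Longrightarrow> \<bar>F z\<bar> \<le> C"
    unfolding bounded_iff by (metis imageI mem_cball_0 real_norm_def)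
  show thesis
  proof (rule that[of "2 * C"])
    fix z assume z: "z \<in> S"
    let ?u = "sgn (dF z)"
    have "dF z \<bullet> ((z + ?u) - z) \<le> F (z + ?u) - F z" by (rule convex_GDERIV_le[OF convex grad])
    moreover have "dF z \<bullet> ((z + ?u) - z) = norm (dF z)"
      by (cases "dF z = 0") (simp_all add: sgn_div_norm dot_square_norm power2_eq_square)
    moreover have "norm (z + ?u) \<le> R + 1"
      using R[OF z] norm_triangle_ineq[of z ?u] by (simp add: norm_sgn split: if_splits)
    moreover have "norm z \<le> R + 1" using R[OF z] by simp
    ultimately show "norm (dF z) \<le> 2 * C" using C[of "z + ?u"] C[of z] by linarith
  qed
qed

lemma abs_continuous_C1:
  fixes f :: "real \<Rightarrow> real"
  assumes der: "\<And>t. 0 < t \<Longrightarrow> (f has_real_derivative f' t) (at t within {t0..T})"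
    and cont: "continuous_on {t0..T} f'"
  shows "abs_continuous_on_interval t0 T f"
proof -
  have "bounded (f' ` {t0..T})" by (intro compact_imp_bounded compact_continuous_image cont) simp
  then obtain B where "\<And>t. t \<in> {t0..T} \<Longrightarrow> norm (f' t) \<le> B"
    unfolding bounded_iff by (metis imageI)
  then show ?thesis
    using der t0_pos
    by (intro abs_continuous_on_interval_bounded_derivative[of t0 T f f' B])
      (auto simp: has_real_derivative_iff_has_vector_derivative)
qed

text \<open>On a compact interval \<open>x\<close>, \<open>F\<close> along \<open>x\<close> and the
  weights are Lipschitz, and \<open>v\<close> is absolutely continuous by assumption. The energy is
  built from them by sums and products.\<close>

lemma energy_abs_continuous:
  assumes "t0 \<le> T"
  shows "abs_continuous_on_interval t0 T (\<lambda>t. t powr c * energy l t)"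
proof -
  note ac = abs_continuous_on_interval_add abs_continuous_on_interval_const
    bounded_bilinear.abs_continuous_on_interval_prod[OF bounded_bilinear_mult]
    bounded_bilinear.abs_continuous_on_interval_prod[OF bounded_bilinear_inner]
    bounded_bilinear.abs_continuous_on_interval_prod[OF bounded_bilinear_scaleR]
  obtain V where V: "V > 0" "\<And>t. t \<in> {t0..T} \<Longrightarrow> norm (v t) \<le> V"
    using abs_continuous_on_interval_bounded[OF v_ac[OF assms]] by blast
  have x: "abs_continuous_on_interval t0 T x"
    by (rule abs_continuous_on_interval_bounded_derivative[of _ _ _ v V])
      (use V in \<open>auto intro!: has_vector_derivative_within_subset[OF x_deriv]\<close>)
  have "bounded (x ` {t0..T})"
    using continuous_on_subset[OF continuous_x] by (intro compact_imp_bounded compact_continuous_image) auto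
  then obtain B where B: "\<And>z. z \<in> x ` {t0..T} \<Longrightarrow> norm (dF z) \<le> B" using dF_bounded by blast
  have Fx: "abs_continuous_on_interval t0 T (\<lambda>t. F (x t))"
  proof (rule abs_continuous_on_interval_bounded_derivative)
    fix t assume t: "t \<in> {t0..T}"
    show "((\<lambda>t. F (x t)) has_vector_derivative dF (x t) \<bullet> v t) (at t within {t0..T})"
      using DERIV_subset[OF F_deriv, of t "{t0..T}"] t
      by (simp add: has_real_derivative_iff_has_vector_derivative subset_eq)
    have "norm (dF (x t) \<bullet> v t) \<le> norm (dF (x t)) * norm (v t)"
      by (simp add: Cauchy_Schwarz_ineq2)
    also have "\<dots> \<le> B * V" using B[of "x t"] V t
      by (intro mult_mono) (auto intro: order_trans[OF norm_ge_zero])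
    finally show "norm (dF (x t) \<bullet> v t) \<le> B * V" .
  qed
  have inv: "abs_continuous_on_interval t0 T (\<lambda>t. l / t)"
    by (rule abs_continuous_C1[of _ "\<lambda>t. - l / t\<^sup>2"])
      (use t0_pos in \<open>auto intro!: derivative_eq_intros continuous_intros simp: power2_eq_square\<close>)
  have pow: "abs_continuous_on_interval t0 T (\<lambda>t. t powr c)"
    by (rule abs_continuous_C1[of _ "\<lambda>t. c * t powr (c - 1)"])
      (use t0_pos in \<open>auto intro!: has_real_derivative_powr[THEN DERIV_subset] continuous_intros\<close>)
  have xi: "abs_continuous_on_interval t0 T (xi l)"
    by (rule abs_continuous_C1[OF xi_deriv])
      (use t0_pos in \<open>auto intro!: continuous_intros\<close>)
  have y: "abs_continuous_on_interval t0 T (\<lambda>t. x t + - xs)" by (intro ac x)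
  have "abs_continuous_on_interval t0 T (\<lambda>t. t powr c *
      (F (x t) + - F xs + (1 / 2) * (((l / t) *\<^sub>R (x t + - xs) + v t) \<bullet> ((l / t) *\<^sub>R (x t + - xs) + v t))
      + (1 / 2) * (xi l t * ((x t + - xs) \<bullet> (x t + - xs)))))"
    by (intro ac pow Fx inv xi x v_ac assms)
  then show ?thesis by (simp add: energy_def w_def)
qed

text \<open>Integrates \<open>energy_deriv\<close>, which holds almost everywhere. Since
  \<open>\<phi>\<close> only has to majorize the derivative, each application supplies a majorant of
  known integral; Cauchy-Schwarz has already been applied to the forcing term.\<close>

lemma energy_increment_le:
  assumes T: "t0 \<le> T" "T \<le> t" and \<phi>: "\<phi> integrable_on {T..t}"
    and le: "\<And>s. s \<in> {T..t} \<Longrightarrow> s powr c *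
     (c / s * (F (x s) - F xs) - l / s * (dF (x s) \<bullet> (x s - xs))
      + ((c / 2 + l) / s - \<alpha> / s powr \<theta>) * (norm (w l s))\<^sup>2
      + rest_coeff c l s * (norm (x s - xs))\<^sup>2 + norm (w l s) * norm (g s)) \<le> \<phi> s"
  shows "t powr c * energy l t \<le> T powr c * energy l T + integral {T..t} \<phi>"
proof -
  let ?ode = "\<lambda>s. \<exists>a. (v has_vector_derivative a) (at s within {t0..}) \<and>
    a + (\<alpha> / s powr \<theta>) *\<^sub>R v s + dF (x s) = g s"
  obtain N where N: "N \<in> null_sets lebesgue"
    and sub: "{s \<in> space lebesgue. \<not> (t0 \<le> s \<longrightarrow> ?ode s)} \<subseteq> N"
    using ode unfolding eventually_ae_filter by blast
  have ode_N: "?ode s" if "s \<notin> N" "t0 \<le> s" for s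
    using sub that by auto
  have "t powr c * energy l t - T powr c * energy l T \<le> integral {T..t} \<phi>"
  proof (rule abs_continuous_increment_le_integral[OF T(2) _ _ _ \<phi>])
    show "abs_continuous_on_interval T t (\<lambda>t. t powr c * energy l t)"
      by (rule abs_continuous_on_interval_subset[OF energy_abs_continuous[of t]]) (use T in auto)
    show "negligible N" using N by (simp add: negligible_iff_null_sets)
    fix s assume s: "s \<in> {T..t}" "s \<notin> N"
    then obtain a where a: "(v has_vector_derivative a) (at s within {t0..})"
        "a + (\<alpha> / s powr \<theta>) *\<^sub>R v s + dF (x s) = g s"
      using ode_N[of s] T by auto
    let ?d = "\<lambda>r. s powr c * (c / s * (F (x s) - F xs) - l / s * (dF (x s) \<bullet> (x s - xs))
      + ((c / 2 + l) / s - \<alpha> / s powr \<theta>) * (norm (w l s))\<^sup>2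
      + rest_coeff c l s * (norm (x s - xs))\<^sup>2 + r)"
    have "((\<lambda>t. t powr c * energy l t) has_real_derivative ?d (w l s \<bullet> g s)) (at s within {T..t})"
      by (rule DERIV_subset[OF energy_deriv[OF _ a]]) (use s T in auto)
    moreover have "?d (w l s \<bullet> g s) \<le> ?d (norm (w l s) * norm (g s))"
      by (intro mult_left_mono add_left_mono norm_cauchy_schwarz) simp
    ultimately show "\<exists>f'. ((\<lambda>t. t powr c * energy l t) has_real_derivative f') (at s within {T..t}) \<and> f' \<le> \<phi> s"
      using le[OF s(1)] order_trans by blast
  qed
  then show ?thesis by simp
qed

section \<open>Decay of the energy\<close>

definition G :: real where
  "G = integral {t0..} (\<lambda>t. t powr k * norm (g t))"

lemma G_nonneg: "0 \<le> G"
  unfolding G_def by (intro integral_nonneg g_int) auto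

lemma forcing_integral_le:
  assumes "t0 \<le> T"
  shows "(\<lambda>t. t powr k * norm (g t)) integrable_on {T..t}"
    and "integral {T..t} (\<lambda>t. t powr k * norm (g t)) \<le> G"
proof -
  show *: "(\<lambda>t. t powr k * norm (g t)) integrable_on {T..t}"
    by (rule integrable_on_subinterval[OF g_int]) (use assms in auto)
  show "integral {T..t} (\<lambda>t. t powr k * norm (g t)) \<le> G"
    unfolding G_def by (rule integral_subset_le[OF _ * g_int]) (use assms in auto)
qed

text \<open>This is flatness with exponent one, valid everywhere; it serves as long as the
  trajectory is not yet known to approach \<open>xs\<close>.\<close>

lemma gap_le_inner: "F z - F xs \<le> dF z \<bullet> (z - xs)"
  using convex_GDERIV_le[OF convex grad[of z], of xs] by (simp add: inner_diff_right)

text \<open>The mechanical energy grows at most through \<open>norm (v s) * norm (g s)\<close>, so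
  the running maximum argument bounds \<open>v\<close> and then the energy. Linear growth of
  \<open>F\<close> away from \<open>xs\<close> turns this into a bound on \<open>x\<close>.\<close>

lemma bounded_trajectory:
  obtains V Y where "\<And>t. t0 \<le> t \<Longrightarrow> norm (v t) \<le> V" "\<And>t. t0 \<le> t \<Longrightarrow> norm (x t - xs) \<le> Y"
proof -
  have en: "t powr 0 * energy 0 t = F (x t) - F xs + (norm (v t))\<^sup>2 / 2" if "t0 \<le> t" for t
    using that t0_pos by (simp add: energy_def w_def xi_def power2_norm_eq_inner)
  define E0 where "E0 = F (x t0) - F xs + (norm (v t0))\<^sup>2 / 2"
  have E0: "0 \<le> E0" using gap_nonneg by (simp add: E0_def)
  have energy_le: "F (x t) - F xs + (norm (v t))\<^sup>2 / 2 \<le> E0 + Z * t0 powr (- k) * G"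
    if t: "t0 \<le> t" and Z: "Z \<ge> 0" "\<And>s. s \<in> {t0..t} \<Longrightarrow> norm (v s) \<le> Z" for t Z
  proof -
    have "t powr 0 * energy 0 t \<le> t0 powr 0 * energy 0 t0
        + integral {t0..t} (\<lambda>s. Z * t0 powr (- k) * (s powr k * norm (g s)))"
    proof (rule energy_increment_le[OF order_refl t])
      show "(\<lambda>s. Z * t0 powr (- k) * (s powr k * norm (g s))) integrable_on {t0..t}"
        by (intro integrable_on_mult_right forcing_integral_le) simp
      fix s assume s: "s \<in> {t0..t}"
      then have "s > 0" using t0_pos by auto
      \<comment> \<open>The weight is at least \<open>t0 powr k\<close>, so the unweighted norm of
        \<open>g\<close> is controlled by the weighted one.\<close>
      have "1 = t0 powr (- k) * t0 powr k" using t0_pos by (simp flip: powr_add)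
      also have "\<dots> \<le> t0 powr (- k) * s powr k"
        using s t0_pos k by (intro mult_left_mono powr_mono2) auto
      finally have one: "1 \<le> t0 powr (- k) * s powr k" .
      have "norm (v s) * norm (g s) \<le> Z * norm (g s)"
        using Z s by (intro mult_right_mono) auto
      also have "\<dots> \<le> Z * norm (g s) * (t0 powr (- k) * s powr k)"
        using mult_left_mono[OF one, of "Z * norm (g s)"] Z(1) by simp
      finally have "norm (v s) * norm (g s) \<le> Z * t0 powr (- k) * (s powr k * norm (g s))"
        by (simp add: mult_ac)
      moreover have "0 \<le> \<alpha> / s powr \<theta> * (norm (v s))\<^sup>2" using \<alpha>_pos by simp
      ultimately show "s powr 0 *
     (0 / s * (F (x s) - F xs) - 0 / s * (dF (x s) \<bullet> (x s - xs))
      + ((0 / 2 + 0) / s - \<alpha> / s powr \<theta>) * (norm (w 0 s))\<^sup>2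
      + rest_coeff 0 0 s * (norm (x s - xs))\<^sup>2 + norm (w 0 s) * norm (g s))
       \<le> Z * t0 powr (- k) * (s powr k * norm (g s))"
        using \<open>s > 0\<close> by (simp add: rest_coeff_def w_def)
    qed
    moreover have "integral {t0..t} (\<lambda>s. Z * t0 powr (- k) * (s powr k * norm (g s))) \<le> Z * t0 powr (- k) * G"
      unfolding integral_mult_right
      by (intro mult_left_mono forcing_integral_le) (use Z in auto)
    ultimately show ?thesis using en[OF t] en[OF order_refl] unfolding E0_def by linarith
  qed
  have "\<exists>B\<ge>0. \<forall>t\<ge>t0. norm (v t) \<le> B"
  proof (rule bounded_of_square_le_running_maximum)
    show "continuous_on {t0..t} (\<lambda>t. norm (v t))" for t
      by (intro continuous_intros continuous_v)
    show "0 \<le> 2 * E0" "0 \<le> 2 * t0 powr (- k) * G" using E0 G_nonneg by auto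
    fix t Z assume tZ: "t0 \<le> t" "\<And>s. s \<in> {t0..t} \<Longrightarrow> norm (v s) \<le> Z" "0 \<le> Z"
    show "(norm (v t))\<^sup>2 \<le> 2 * E0 + 2 * t0 powr (- k) * G * Z"
      using energy_le[OF tZ(1,3,2)] gap_nonneg[of "x t"] by (simp add: mult_ac)
  qed
  then obtain V where V: "V \<ge> 0" "\<And>t. t0 \<le> t \<Longrightarrow> norm (v t) \<le> V" by blast
  obtain m where m: "m > 0" "\<And>z. 1 \<le> norm (z - xs) \<Longrightarrow> m * norm (z - xs) \<le> F z - F xs"
    using convex_unique_minimizer_growth[OF convex continuous_F strict_min zero_less_one] by blast
  define W where "W = E0 + V * t0 powr (- k) * G"
  have "norm (x t - xs) \<le> 1 + W / m" if t: "t0 \<le> t" for t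
  proof (cases "1 \<le> norm (x t - xs)")
    case True
    have "F (x t) - F xs + (norm (v t))\<^sup>2 / 2 \<le> W"
      unfolding W_def using V by (intro energy_le t) auto
    with m(2)[OF True] have "m * norm (x t - xs) \<le> W" using zero_le_power2[of "norm (v t)"] by linarith
    then have "norm (x t - xs) \<le> W / m" using m(1) by (simp add: pos_le_divide_eq mult.commute)
    then show ?thesis by simp
  next
    case False
    have "0 \<le> W" using E0 V(1) G_nonneg by (simp add: W_def)
    then have "0 \<le> W / m" using m(1) by simp
    with False show ?thesis by linarith
  qed
  with V(2) show thesis by (rule that)
qed

text \<open>With \<open>c = l\<close> small, every contribution to the derivative is either
  nonpositive or integrable, so \<open>t powr l * energy l t\<close> stays bounded and the gap is of
  order \<open>t powr (- l)\<close>.\<close>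

lemma gap_tendsto_zero: "((\<lambda>t. F (x t) - F xs) \<longlongrightarrow> 0) at_top"
proof -
  obtain V Y where V: "\<And>t. t0 \<le> t \<Longrightarrow> norm (v t) \<le> V" and Y: "\<And>t. t0 \<le> t \<Longrightarrow> norm (x t - xs) \<le> Y"
    using bounded_trajectory by blast
  have "V \<ge> 0" "Y \<ge> 0" using V[of t0] Y[of t0] norm_ge_zero order_trans by blast+
  \<comment> \<open>The bound 1/2 gives \<open>l \<le> k\<close> for the forcing and makes
    \<open>s powr (l - 2)\<close> integrable at infinity; the bound \<open>2 * \<alpha> / 3\<close>
    lets the damping absorb the coefficient \<open>3 / 2 * l\<close> of \<open>norm (w l s)\<close>
    squared.\<close>
  define l where "l = min (1 / 2) (2 * \<alpha> / 3)"
  have l: "0 < l" "l \<le> 1 / 2" "3 / 2 * l \<le> \<alpha>" using \<alpha>_pos by (auto simp: l_def)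
  define T where "T = max t0 1"
  have T: "T \<ge> t0" "T \<ge> 1" by (auto simp: T_def)
  define M where "M = V + Y"
  have w_le: "norm (w l s) \<le> M" if "s \<ge> T" for s
  proof -
    have "norm (w l s) \<le> l / s * norm (x s - xs) + norm (v s)"
      unfolding w_def using that T l norm_triangle_ineq[of "(l / s) *\<^sub>R (x s - xs)" "v s"] by simp
    also have "\<dots> \<le> 1 * Y + V"
      using that T l Y[of s] V[of s] by (intro add_mono mult_mono) auto
    finally show ?thesis by (simp add: M_def)
  qed
  have "M \<ge> 0" using \<open>V \<ge> 0\<close> \<open>Y \<ge> 0\<close> by (simp add: M_def)
  let ?p = "\<lambda>s::real. s powr (- 3 / 2)"
  have p_int: "(?p has_integral 2 * T powr (- 1 / 2)) {T..}"
    using has_integral_powr_to_inf[of "- 3 / 2" T] T by (simp add: mult.commute)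
  define C where "C = \<bar>T powr l * energy l T\<bar> + (2 * \<alpha> * Y\<^sup>2 * (2 * T powr (- 1 / 2)) + M * G)"
  have energy_le: "t powr l * energy l t \<le> C" if t: "t \<ge> T" for t
  proof -
    let ?\<phi> = "\<lambda>s. 2 * \<alpha> * Y\<^sup>2 * ?p s + M * (s powr k * norm (g s))"
    have pi: "?p integrable_on {T..t}"
      by (rule integrable_on_subinterval[OF has_integral_integrable[OF p_int]]) auto
    note gi = forcing_integral_le(1)[OF T(1), of t]
    have "t powr l * energy l t \<le> T powr l * energy l T + integral {T..t} ?\<phi>"
    proof (rule energy_increment_le[OF T(1) t])
      show "?\<phi> integrable_on {T..t}" by (intro integrable_add integrable_on_mult_right pi gi)
      fix s assume s: "s \<in> {T..t}"
      then have s1: "s \<ge> 1" "s \<ge> t0" "s > 0" using T by auto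
      have "l / s * (F (x s) - F xs) - l / s * (dF (x s) \<bullet> (x s - xs)) \<le> 0"
        using mult_left_mono[OF gap_le_inner, of "l / s" "x s"] s1 l by simp
      moreover have "((l / 2 + l) / s - \<alpha> / s powr \<theta>) * (norm (w l s))\<^sup>2 \<le> 0"
      proof (rule mult_nonpos_nonneg)
        have "s powr \<theta> \<le> s" using powr_mono[OF \<theta>(2) s1(1)] s1 by simp
        then have "(3 / 2 * l) / s \<le> \<alpha> / s powr \<theta>"
          using l s1 \<alpha>_pos by (intro frac_le) auto
        then show "(l / 2 + l) / s - \<alpha> / s powr \<theta> \<le> 0" by simp
      qed simp
      moreover have "rest_coeff l l s * (norm (x s - xs))\<^sup>2 \<le> 2 * \<alpha> * s powr (- 2) * Y\<^sup>2"
      proof (rule mult_mono)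
        \<comment> \<open>The first summand is negative and is dropped; the second decays at least
          like \<open>s powr (- 2)\<close>.\<close>
        have "rest_coeff l l s = - (l * (l + 1) * (l / 2 + 1) / s ^ 3)
            + l * \<alpha> * (l / 2 + (1 + \<theta>) / 2) / s powr (2 + \<theta>)"
          by (simp add: rest_coeff_def algebra_simps add_divide_distrib diff_divide_distrib)
        also have "\<dots> \<le> 0 + 2 * \<alpha> / s powr 2"
        proof (intro add_mono frac_le)
          have "l * (l / 2 + (1 + \<theta>) / 2) \<le> 1 * 2"
            using l \<theta> by (intro mult_mono) (simp_all add: add_divide_distrib)
          then show "l * \<alpha> * (l / 2 + (1 + \<theta>) / 2) \<le> 2 * \<alpha>"
            using mult_left_mono[of "l * (l / 2 + (1 + \<theta>) / 2)" 2 \<alpha>] \<alpha>_pos by (simp add: mult_ac)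
          show "s powr 2 \<le> s powr (2 + \<theta>)" using s1 \<theta> by (intro powr_mono) auto
        qed (use l \<alpha>_pos s1 in auto)
        finally show "rest_coeff l l s \<le> 2 * \<alpha> * s powr (- 2)"
          by (simp add: powr_minus divide_inverse)
        show "(norm (x s - xs))\<^sup>2 \<le> Y\<^sup>2" using Y[OF s1(2)] by (intro power_mono) auto
      qed (use \<alpha>_pos in auto)
      moreover have "norm (w l s) * norm (g s) \<le> M * norm (g s)"
        using w_le s by (intro mult_right_mono) auto
      ultimately have "s powr l *
       (l / s * (F (x s) - F xs) - l / s * (dF (x s) \<bullet> (x s - xs))
        + ((l / 2 + l) / s - \<alpha> / s powr \<theta>) * (norm (w l s))\<^sup>2
        + rest_coeff l l s * (norm (x s - xs))\<^sup>2 + norm (w l s) * norm (g s))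
        \<le> s powr l * (2 * \<alpha> * s powr (- 2) * Y\<^sup>2 + M * norm (g s))"
        by (intro mult_left_mono) (linarith, simp)
      also have "\<dots> = 2 * \<alpha> * Y\<^sup>2 * s powr (l - 2) + M * (s powr l * norm (g s))"
        by (simp add: algebra_simps flip: powr_add)
      also have "\<dots> \<le> ?\<phi> s"
        using \<alpha>_pos s1 l k \<open>M \<ge> 0\<close> by (intro add_mono mult_left_mono mult_right_mono powr_mono) auto
      finally show "s powr l *
       (l / s * (F (x s) - F xs) - l / s * (dF (x s) \<bullet> (x s - xs))
        + ((l / 2 + l) / s - \<alpha> / s powr \<theta>) * (norm (w l s))\<^sup>2
        + rest_coeff l l s * (norm (x s - xs))\<^sup>2 + norm (w l s) * norm (g s)) \<le> ?\<phi> s" .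
    qed
    also have "integral {T..t} ?\<phi> = 2 * \<alpha> * Y\<^sup>2 * integral {T..t} ?p
        + M * integral {T..t} (\<lambda>s. s powr k * norm (g s))"
      using integral_add[OF integrable_on_mult_right[OF pi] integrable_on_mult_right[OF gi]] by simp
    also have "integral {T..t} ?p \<le> 2 * T powr (- 1 / 2)"
      using integral_subset_le[OF _ pi has_integral_integrable[OF p_int]] integral_unique[OF p_int] by auto
    also have "integral {T..t} (\<lambda>s. s powr k * norm (g s)) \<le> G" by (rule forcing_integral_le[OF T(1)])
    finally show ?thesis
      using \<alpha>_pos \<open>M \<ge> 0\<close> abs_ge_self[of "T powr l * energy l T"]
      unfolding C_def by (auto simp: mult_left_mono add_mono)
  qed
  have gap_le: "F (x t) - F xs \<le> (C + \<alpha> * Y\<^sup>2) * t powr (- l)" if t: "t \<ge> T" for t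
  proof -
    have t1: "t \<ge> 1" "t \<ge> t0" "t > 0" using t T by auto
    have "energy l t \<le> C * t powr (- l)"
      using energy_le[OF t] t1 by (simp add: powr_minus field_simps)
    \<comment> \<open>Only the damping part of \<open>xi\<close> is negative. It decays like
      \<open>t powr (- (1 + \<theta>))\<close>, which is faster than
      \<open>t powr (- l)\<close>.\<close>
    moreover have "- (xi l t * ((x t - xs) \<bullet> (x t - xs)) / 2) \<le> \<alpha> * Y\<^sup>2 * t powr (- l)"
    proof -
      have "- xi l t \<le> l * \<alpha> / t powr (1 + \<theta>)" using l by (simp add: xi_def)
      also have "\<dots> \<le> (2 * \<alpha>) / t powr l"
        using l \<theta> \<alpha>_pos t1 by (intro frac_le mult_right_mono powr_mono) auto
      finally have "- xi l t * (norm (x t - xs))\<^sup>2 \<le> (2 * \<alpha>) / t powr l * Y\<^sup>2"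
        using Y[OF t1(2)] \<alpha>_pos by (intro mult_mono power_mono) auto
      then show ?thesis by (simp add: powr_minus field_simps power2_norm_eq_inner)
    qed
    moreover have "0 \<le> w l t \<bullet> w l t" by simp
    ultimately show ?thesis unfolding energy_def distrib_right by linarith
  qed
  show ?thesis
  proof (rule tendsto_sandwich)
    show "\<forall>\<^sub>F t in at_top. 0 \<le> F (x t) - F xs" using gap_nonneg by simp
    show "\<forall>\<^sub>F t in at_top. F (x t) - F xs \<le> (C + \<alpha> * Y\<^sup>2) * t powr (- l)"
      using gap_le by (auto simp: eventually_at_top_linorder)
    show "((\<lambda>t. (C + \<alpha> * Y\<^sup>2) * t powr (- l)) \<longlongrightarrow> 0) at_top"
      using l by (intro tendsto_mult_right_zero tendsto_neg_powr filterlim_ident) auto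
  qed simp
qed

text \<open>Outside the ball the gap is at least \<open>m * \<rho>\<close>, which is impossible once
  the gap is small.\<close>

lemma eventually_near_minimizer:
  assumes "\<rho> > 0"
  shows "\<forall>\<^sub>F t in at_top. norm (x t - xs) < \<rho>"
proof -
  obtain m where m: "m > 0" "\<And>z. \<rho> \<le> norm (z - xs) \<Longrightarrow> m * norm (z - xs) \<le> F z - F xs"
    using convex_unique_minimizer_growth[OF convex continuous_F strict_min assms] by blast
  have "\<forall>\<^sub>F t in at_top. F (x t) - F xs < m * \<rho>"
    using order_tendstoD(2)[OF gap_tendsto_zero] m(1) assms by simp
  then show ?thesis
  proof eventually_elim
    case (elim t)
    show ?case
    proof (rule ccontr)
      assume "\<not> norm (x t - xs) < \<rho>"
      then have \<rho>: "\<rho> \<le> norm (x t - xs)" by simp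
      then have "m * \<rho> \<le> m * norm (x t - xs)" using m(1) by simp
      then show False using m(2)[OF \<rho>] elim by linarith
    qed
  qed
qed

text \<open>The energy inequality is run with the large weight exponent \<open>c\<close> and then
  divided by \<open>t powr (c - 2 * k)\<close>. At the exponent \<open>2 * k\<close> the growth
  condition allows the negative part of \<open>xi\<close> to be absorbed into half of the rescaled
  gap.\<close>

lemma gap_decay:
  assumes \<gamma>: "\<gamma>1 > 2" "\<gamma>2 \<ge> \<gamma>1" and k_eq: "k = (1 + \<theta>) / 2 * \<gamma>2 / (\<gamma>2 - 2)"
    and damping: "(\<theta> = 1 \<and> \<alpha> \<ge> (\<gamma>1 + 2) / (\<gamma>1 - 2)) \<or> \<theta> < 1"
    and "\<eta> > 0" and flat: "\<And>z. norm (z - xs) < \<eta> \<Longrightarrow> F z - F xs \<le> (1 / \<gamma>1) * (dF z \<bullet> (z - xs))"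
    and "\<epsilon> > 0" and "K > 0"
    and growth: "\<And>z. norm (z - xs) < \<epsilon> \<Longrightarrow> K * norm (z - xs) powr \<gamma>2 \<le> F z - F xs"
  shows "\<exists>C T. \<forall>t\<ge>T. F (x t) - F xs \<le> C * t powr (- 2 * k)"
proof -
  \<comment> \<open>Two demands fix \<open>l\<close>: \<open>c = 2 * l + 2\<close> cancels the first
    term of \<open>rest_coeff\<close>, and \<open>c = l * \<gamma>1\<close> matches the gap terms to
    the flatness condition.\<close>
  define l where "l = 2 / (\<gamma>1 - 2)"
  define c where "c = 2 * l + 2"
  define p where "p = 2 / \<gamma>2"
  have l: "l > 0" and c_eq: "c = l * \<gamma>1" using \<gamma> by (auto simp: l_def c_def field_simps)
  have p: "0 < p" "p < 1" using \<gamma> by (auto simp: p_def)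
  have k_le: "2 * k \<le> c"
  proof -
    have "\<gamma>2 / (\<gamma>2 - 2) = 1 + 2 / (\<gamma>2 - 2)" using \<gamma> by (simp add: field_simps)
    also have "\<dots> \<le> 1 + l" using \<gamma> unfolding l_def by (intro add_left_mono frac_le) auto
    finally have "(1 + \<theta>) / 2 * (\<gamma>2 / (\<gamma>2 - 2)) \<le> 1 * (1 + l)"
      using \<gamma> \<theta> by (intro mult_mono) auto
    then show ?thesis by (simp add: k_eq c_def)
  qed
  \<comment> \<open>This identity selects the rate: multiplying
    \<open>t powr (- (1 + \<theta>))\<close> times the \<open>p\<close>-th power of the gap by
    \<open>t powr (2 * k)\<close> gives exactly \<open>X t powr p\<close>.\<close>
  have kp: "2 * k - (1 + \<theta>) = 2 * k * p" using \<gamma> by (simp add: k_eq p_def field_simps)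
  \<comment> \<open>Here \<open>c / 2 + l\<close> equals
    \<open>(\<gamma>1 + 2) / (\<gamma>1 - 2)\<close>, the threshold for \<open>\<alpha>\<close> when
    \<open>\<theta> = 1\<close>. For \<open>\<theta> < 1\<close> the damping eventually exceeds any
    multiple of \<open>1 / s\<close>.\<close>
  have "\<forall>\<^sub>F s in at_top. (c / 2 + l) / s \<le> \<alpha> / s powr \<theta>"
    using damping
  proof
    assume *: "\<theta> = 1 \<and> \<alpha> \<ge> (\<gamma>1 + 2) / (\<gamma>1 - 2)"
    have "c / 2 + l = 2 * l + 1" by (simp add: c_def)
    also have "\<dots> = (\<gamma>1 + 2) / (\<gamma>1 - 2)" using \<gamma> by (simp add: l_def field_simps)
    finally have "c / 2 + l = (\<gamma>1 + 2) / (\<gamma>1 - 2)" .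
    then have "(c / 2 + l) / s \<le> \<alpha> / s powr \<theta>" if "s \<ge> 1" for s
      using * that divide_right_mono[of "(\<gamma>1 + 2) / (\<gamma>1 - 2)" \<alpha> s] by simp
    then show ?thesis by (auto simp: eventually_at_top_linorder)
  next
    assume *: "\<theta> < 1"
    define s0 where "s0 = max 1 (((c / 2 + l) / \<alpha>) powr (1 / (1 - \<theta>)))"
    have "(c / 2 + l) / s \<le> \<alpha> / s powr \<theta>" if "s \<ge> s0" for s
    proof -
      have s: "s \<ge> 1" "((c / 2 + l) / \<alpha>) powr (1 / (1 - \<theta>)) \<le> s" using that by (auto simp: s0_def)
      have "(c / 2 + l) / \<alpha> = (((c / 2 + l) / \<alpha>) powr (1 / (1 - \<theta>))) powr (1 - \<theta>)"
        using * l \<alpha>_pos by (simp add: powr_powr c_def)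
      also have "\<dots> \<le> s powr (1 - \<theta>)" using s * by (intro powr_mono2) auto
      also have "\<dots> = s / s powr \<theta>" using s by (simp add: powr_diff)
      finally show ?thesis using s \<alpha>_pos by (simp add: field_simps)
    qed
    then show ?thesis by (auto simp: eventually_at_top_linorder)
  qed
  moreover note eventually_near_minimizer[OF \<open>\<eta> > 0\<close>] eventually_near_minimizer[OF \<open>\<epsilon> > 0\<close>]
    eventually_ge_at_top[of "max 1 t0"]
  ultimately have "\<forall>\<^sub>F s in at_top. (c / 2 + l) / s \<le> \<alpha> / s powr \<theta> \<and> norm (x s - xs) < \<eta>
      \<and> norm (x s - xs) < \<epsilon> \<and> max 1 t0 \<le> s"
    by eventually_elim auto
  then obtain T where T': "\<And>s. s \<ge> T \<Longrightarrow> (c / 2 + l) / s \<le> \<alpha> / s powr \<theta> \<and> norm (x s - xs) < \<eta>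
      \<and> norm (x s - xs) < \<epsilon> \<and> max 1 t0 \<le> s"
    by (auto simp: eventually_at_top_linorder)
  have T: "t0 \<le> T" "1 \<le> T" using T'[of T] by auto
  \<comment> \<open>\<open>X\<close> and \<open>z\<close> are the gap and the norm of
    \<open>w\<close> rescaled at the target rate; both turn out to be bounded.\<close>
  define X where "X t = t powr (2 * k) * (F (x t) - F xs)" for t
  have X_nonneg: "0 \<le> X t" for t
    unfolding X_def by (intro mult_nonneg_nonneg gap_nonneg powr_ge_zero)
  define z where "z t = t powr k * norm (w l t)" for t
  define D where "D = l * \<alpha> / 2 * K powr (- p)"
  have "D \<ge> 0" using l \<alpha>_pos by (simp add: D_def)
  obtain C1 where C1: "\<And>X. X \<ge> 0 \<Longrightarrow> D * X powr p \<le> X / 2 + C1" "C1 \<ge> 0"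
    using powr_le_linear_plus_const[OF p(2) \<open>D \<ge> 0\<close> p(1)] by blast
  define C0 where "C0 = \<bar>T powr c * energy l T\<bar>"
  have main: "X t / 2 + (z t)\<^sup>2 / 2 \<le> C0 + C1 + Z * G"
    if t: "T \<le> t" and Z: "\<And>s. s \<in> {T..t} \<Longrightarrow> z s \<le> Z" "Z \<ge> 0" for t Z
  proof -
    have t1: "t \<ge> 1" "t \<ge> t0" "t > 0" using t T by auto
    \<comment> \<open>The end point \<open>t\<close> is fixed in the majorant: since
      \<open>c - 2 * k \<ge> 0\<close>, the factor \<open>s powr (c - 2 * k)\<close> is at most its
      value at \<open>t\<close>, which is divided out afterwards.\<close>
    let ?\<phi> = "\<lambda>s. t powr (c - 2 * k) * Z * (s powr k * norm (g s))"
    note gi = forcing_integral_le[OF T(1), of t]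
    have "t powr c * energy l t \<le> T powr c * energy l T + integral {T..t} ?\<phi>"
    proof (rule energy_increment_le[OF T(1) t])
      show "?\<phi> integrable_on {T..t}" by (intro integrable_on_mult_right gi)
      fix s assume s: "s \<in> {T..t}"
      then have s1: "s \<ge> 1" "s > 0" using T by auto
      note Ts = T'[of s]
      have "c / s * (F (x s) - F xs) - l / s * (dF (x s) \<bullet> (x s - xs)) \<le> 0"
      proof -
        have "\<gamma>1 * (F (x s) - F xs) \<le> dF (x s) \<bullet> (x s - xs)"
          using flat[of "x s"] Ts s \<gamma> by (simp add: field_simps)
        from mult_left_mono[OF this, of "l / s"] show ?thesis
          using l s1 by (simp add: c_eq mult_ac)
      qed
      moreover have "((c / 2 + l) / s - \<alpha> / s powr \<theta>) * (norm (w l s))\<^sup>2 \<le> 0"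
        using Ts s by (intro mult_nonpos_nonneg) auto
      moreover have "rest_coeff c l s * (norm (x s - xs))\<^sup>2 \<le> 0"
      proof (rule mult_nonpos_nonneg)
        \<comment> \<open>Since \<open>c / 2 - l = 1\<close>, only the damping term remains, with
          the factor \<open>(1 - \<theta>) / 2\<close>, which is nonnegative.\<close>
        have "rest_coeff c l s = - (l * \<alpha> * ((1 - \<theta>) / 2) / s powr (2 + \<theta>))"
          unfolding rest_coeff_def c_def by (simp add: field_simps)
        also have "\<dots> \<le> 0" using l \<alpha>_pos \<theta> by simp
        finally show "rest_coeff c l s \<le> 0" .
      qed simp
      ultimately have "s powr c *
       (c / s * (F (x s) - F xs) - l / s * (dF (x s) \<bullet> (x s - xs))
        + ((c / 2 + l) / s - \<alpha> / s powr \<theta>) * (norm (w l s))\<^sup>2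
        + rest_coeff c l s * (norm (x s - xs))\<^sup>2 + norm (w l s) * norm (g s))
        \<le> s powr c * (norm (w l s) * norm (g s))"
        by (intro mult_left_mono) (linarith, simp)
      also have "\<dots> = s powr (c - 2 * k) * z s * (s powr k * norm (g s))"
      proof -
        have "s powr c = s powr (c - 2 * k) * (s powr k * s powr k)" by (simp flip: powr_add)
        then show ?thesis by (simp add: z_def mult_ac)
      qed
      also have "\<dots> \<le> ?\<phi> s"
        using Z s s1 k_le by (intro mult_right_mono mult_mono powr_mono2) (auto simp: z_def)
      finally show "s powr c *
       (c / s * (F (x s) - F xs) - l / s * (dF (x s) \<bullet> (x s - xs))
        + ((c / 2 + l) / s - \<alpha> / s powr \<theta>) * (norm (w l s))\<^sup>2
        + rest_coeff c l s * (norm (x s - xs))\<^sup>2 + norm (w l s) * norm (g s)) \<le> ?\<phi> s" .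
    qed
    also have "\<dots> \<le> C0 + t powr (c - 2 * k) * Z * G"
      unfolding integral_mult_right C0_def
      using Z(2) by (intro add_mono mult_left_mono gi) auto
    also have "\<dots> \<le> t powr (c - 2 * k) * (C0 + Z * G)"
    proof -
      have "1 * C0 \<le> t powr (c - 2 * k) * C0"
        using t1 k_le by (intro mult_right_mono ge_one_powr_ge_zero) (auto simp: C0_def)
      then show ?thesis by (simp add: algebra_simps)
    qed
    also have "t powr c = t powr (c - 2 * k) * t powr (2 * k)" by (simp flip: powr_add)
    finally have "t powr (2 * k) * energy l t \<le> C0 + Z * G"
      using t1 by (simp add: mult.assoc)
    moreover have "t powr (2 * k) * energy l t
        = X t + (z t)\<^sup>2 / 2 + t powr (2 * k) * (xi l t * (norm (x t - xs))\<^sup>2 / 2)"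
    proof -
      have "(z t)\<^sup>2 = t powr (2 * k) * (w l t \<bullet> w l t)"
        by (simp add: z_def power_mult_distrib power2_norm_eq_inner power2_eq_square[of "t powr k"] flip: powr_add)
      then show ?thesis by (simp add: energy_def X_def power2_norm_eq_inner algebra_simps)
    qed
    moreover have "- (t powr (2 * k) * (xi l t * (norm (x t - xs))\<^sup>2 / 2)) \<le> D * X t powr p"
    proof -
      \<comment> \<open>The growth condition raised to the power \<open>p = 2 / \<gamma>2\<close>;
        the constant \<open>D\<close> collects the factors of this bound and of the negative part of
        \<open>xi\<close>.\<close>
      have y: "(norm (x t - xs))\<^sup>2 \<le> K powr (- p) * (F (x t) - F xs) powr p"
      proof (cases "x t = xs")
        case False
        then have y0: "norm (x t - xs) > 0" by simp
        have "norm (x t - xs) powr \<gamma>2 \<le> (F (x t) - F xs) / K"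
          using growth[of "x t"] T'[of t] t \<open>K > 0\<close> by (simp add: field_simps)
        then have "(norm (x t - xs) powr \<gamma>2) powr p \<le> ((F (x t) - F xs) / K) powr p"
          using p by (intro powr_mono2) auto
        also have "(norm (x t - xs) powr \<gamma>2) powr p = (norm (x t - xs))\<^sup>2"
          using \<gamma> y0 by (simp add: powr_powr p_def powr_numeral)
        also have "((F (x t) - F xs) / K) powr p = K powr (- p) * (F (x t) - F xs) powr p"
          using \<open>K > 0\<close> gap_nonneg by (simp add: powr_divide powr_minus field_simps)
        finally show ?thesis .
      qed simp
      have "- xi l t \<le> l * \<alpha> / t powr (1 + \<theta>)" using l by (simp add: xi_def)
      then have "- xi l t * (norm (x t - xs))\<^sup>2
          \<le> l * \<alpha> / t powr (1 + \<theta>) * (K powr (- p) * (F (x t) - F xs) powr p)"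
        using y l \<alpha>_pos by (intro mult_mono) auto
      then have "t powr (2 * k) / 2 * (- xi l t * (norm (x t - xs))\<^sup>2)
          \<le> t powr (2 * k) / 2 * (l * \<alpha> / t powr (1 + \<theta>) * (K powr (- p) * (F (x t) - F xs) powr p))"
        by (rule mult_left_mono) simp
      also have "\<dots> = D * (t powr (2 * k - (1 + \<theta>)) * (F (x t) - F xs) powr p)"
        by (simp add: D_def powr_diff)
      also have "t powr (2 * k - (1 + \<theta>)) * (F (x t) - F xs) powr p = X t powr p"
        unfolding kp X_def using gap_nonneg by (simp add: powr_mult powr_powr)
      finally show ?thesis by (simp add: mult_ac)
    qed
    moreover have "D * X t powr p \<le> X t / 2 + C1"
      by (rule C1(1)[OF X_nonneg])
    ultimately show ?thesis by linarith
  qed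
  \<comment> \<open>Dropping the nonnegative \<open>X t\<close> from \<open>main\<close> leaves a
    quadratic inequality for \<open>z\<close> against its running maximum; the bound on
    \<open>z\<close> then returns through \<open>main\<close> to bound \<open>X\<close>.\<close>
  have "\<exists>B\<ge>0. \<forall>t\<ge>T. z t \<le> B"
  proof (rule bounded_of_square_le_running_maximum)
    show "continuous_on {T..t} z" for t
    proof -
      have "continuous_on {T..t} v" "continuous_on {T..t} x"
        using T by (auto intro: continuous_on_subset[OF continuous_v[of t]] continuous_on_subset[OF continuous_x])
      then show ?thesis
        unfolding z_def w_def using T by (intro continuous_intros) auto
    qed
    show "0 \<le> 2 * (C0 + C1)" "0 \<le> 2 * G" using C1(2) G_nonneg by (auto simp: C0_def)
    fix t Z assume "T \<le> t" "\<And>s. s \<in> {T..t} \<Longrightarrow> z s \<le> Z" "0 \<le> Z"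
    from main[OF this] show "(z t)\<^sup>2 \<le> 2 * (C0 + C1) + 2 * G * Z"
      using X_nonneg[of t] by (simp add: mult_ac)
  qed
  then obtain B where B: "B \<ge> 0" "\<And>t. T \<le> t \<Longrightarrow> z t \<le> B" by blast
  have "F (x t) - F xs \<le> 2 * (C0 + C1 + B * G) * t powr (- 2 * k)" if t: "t \<ge> T" for t
  proof -
    have "X t / 2 + (z t)\<^sup>2 / 2 \<le> C0 + C1 + B * G" by (rule main[OF t _ B(1)]) (use B(2) in auto)
    moreover have "0 \<le> (z t)\<^sup>2 / 2" by simp
    ultimately have "X t / 2 \<le> C0 + C1 + B * G" by linarith
    then have "X t \<le> 2 * (C0 + C1 + B * G)" by simp
    then have "X t * t powr (- 2 * k) \<le> 2 * (C0 + C1 + B * G) * t powr (- 2 * k)"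
      by (rule mult_right_mono) simp
    moreover have "X t * t powr (- 2 * k) = F (x t) - F xs"
      using t T by (simp add: X_def powr_minus)
    ultimately show ?thesis by simp
  qed
  then show ?thesis by blast
qed

end

section \<open>From the stated hypotheses to the trajectory setting\<close>

text \<open>Converts the finite nonnegative integral into gauge integrability. Measurability is
  inherited from the integrable function \<open>g\<close>, cut off by the indicator because nothing
  is known of \<open>g\<close> before \<open>t0\<close>.\<close>

lemma weighted_norm_integrable_on:
  fixes g :: "real \<Rightarrow> 'a::euclidean_space"
  assumes g: "g absolutely_integrable_on {t0..}"
    and fin: "(\<integral>\<^sup>+t\<in>{t0..}. ennreal (t powr k * norm (g t)) \<partial>lebesgue) < \<infinity>"
  shows "(\<lambda>t. t powr k * norm (g t)) integrable_on {t0..}"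
proof -
  have 1: "(\<lambda>t. indicator {t0..} t *\<^sub>R g t) \<in> borel_measurable lebesgue"
    using g unfolding set_integrable_def by (rule borel_measurable_integrable)
  have 2: "(\<lambda>t::real. t powr k) \<in> borel_measurable lebesgue"
    by (intro measurable_completion) simp
  have "(\<lambda>t. t powr k * norm (indicator {t0..} t *\<^sub>R g t)) \<in> borel_measurable lebesgue"
    by (rule borel_measurable_times[OF 2 measurable_compose[OF 1 borel_measurable_norm]])
  moreover have "(\<lambda>t. t powr k * norm (indicator {t0..} t *\<^sub>R g t))
      = (\<lambda>t. indicator {t0..} t *\<^sub>R (t powr k * norm (g t)))"
    by (auto simp: fun_eq_iff indicator_def)
  moreover have "(\<integral>\<^sup>+t. ennreal (norm (indicator {t0..} t *\<^sub>R (t powr k * norm (g t)))) \<partial>lebesgue) < \<infinity>"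
  proof -
    have "(\<integral>\<^sup>+t. ennreal (norm (indicator {t0..} t *\<^sub>R (t powr k * norm (g t)))) \<partial>lebesgue)
       = (\<integral>\<^sup>+t\<in>{t0..}. ennreal (t powr k * norm (g t)) \<partial>lebesgue)"
      by (intro nn_integral_cong) (auto simp: indicator_def)
    with fin show ?thesis by simp
  qed
  ultimately have "set_integrable lebesgue {t0..} (\<lambda>t. t powr k * norm (g t))"
    unfolding set_integrable_def by (intro integrableI_bounded) auto
  then show ?thesis by (rule set_lebesgue_integral_eq_integral)
qed

theorem theorem3p5:
  fixes F :: "real ^ 'n \<Rightarrow> real"
    and g x :: "real \<Rightarrow> real ^ 'n"
    and x0 v0 :: "real ^ 'n"
    and \<alpha> \<theta> t0 \<gamma>1 \<gamma>2 r :: real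
  assumes "convex_on UNIV F"
    and "F differentiable_on UNIV"
    and "\<exists>!xs. xs \<in> minimizers F"
    and "\<alpha> > 0" and "0 \<le> \<theta>" and "\<theta> \<le> 1" and "t0 > 0"
    and "g absolutely_integrable_on {t0..}"
    and "globally_well_posed F g \<alpha> \<theta> t0"
    and "is_solution F g \<alpha> \<theta> t0 x0 v0 x"
    and "\<gamma>1 > 2" and "\<gamma>2 \<ge> \<gamma>1" and "r = (1 + \<theta>) / 2"
    and "(\<integral>\<^sup>+t\<in>{t0..}. ennreal (t powr (r * \<gamma>2 / (\<gamma>2 - 2)) * norm (g t)) \<partial>lebesgue) < \<infinity>"
    and "H1 \<gamma>1 F" and "H2 \<gamma>2 F"
    and "(\<theta> = 1 \<and> \<alpha> \<ge> (\<gamma>1 + 2) / (\<gamma>1 - 2)) \<or> \<theta> < 1"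
  shows "(\<lambda>t. F (x t) - inf_value F) \<in> O[at_top](\<lambda>t. 1 / t powr (2 * r * \<gamma>2 / (\<gamma>2 - 2)))"
proof -
  obtain xs where xs: "xs \<in> minimizers F" and uniq: "\<And>z. z \<in> minimizers F \<Longrightarrow> z = xs"
    using assms(3) by blast
  have min_le: "F xs \<le> F z" for z using xs by (simp add: minimizers_def)
  have minimizers: "minimizers F = {xs}" using xs uniq by blast
  have inf: "inf_value F = F xs"
    unfolding inf_value_def by (rule cInf_eq_minimum) (auto intro: min_le)
  define k where "k = r * \<gamma>2 / (\<gamma>2 - 2)"
  obtain v where v: "\<And>t. t0 \<le> t \<Longrightarrow> (x has_vector_derivative v t) (at t within {t0..})"
    "\<And>T. t0 \<le> T \<Longrightarrow> abs_continuous_on_interval t0 T v"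
    "AE t in lebesgue. t0 \<le> t \<longrightarrow> (\<exists>a. (v has_vector_derivative a) (at t within {t0..}) \<and>
       a + (\<alpha> / t powr \<theta>) *\<^sub>R v t + gradient F (x t) = g t)"
    using assms(10) unfolding is_solution_def by blast
  interpret damped_trajectory F "gradient F" g x v \<alpha> \<theta> t0 k xs
  proof
    show "GDERIV F z :> gradient F z" for z
      using assms(2) by (intro gderiv_gradient) (simp add: differentiable_on_def)
    show "F xs < F z" if "z \<noteq> xs" for z
    proof (rule ccontr)
      assume "\<not> F xs < F z"
      then have "F z \<le> F y" for y using min_le[of y] by linarith
      then have "z = xs" by (intro uniq) (simp add: minimizers_def)
      with that show False by simp
    qed
    \<comment> \<open>Both factors of \<open>k\<close> are bounded below: this quotient by 1, and
      \<open>r\<close> by 1/2 because \<open>\<theta>\<close> is nonnegative.\<close>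
    have "1 \<le> \<gamma>2 / (\<gamma>2 - 2)" using assms(11,12) by (simp add: field_simps)
    then have "1 / 2 * 1 \<le> r * (\<gamma>2 / (\<gamma>2 - 2))"
      using assms(5,13) by (intro mult_mono) auto
    then show "1 / 2 \<le> k" by (simp add: k_def)
    show "(\<lambda>t. t powr k * norm (g t)) integrable_on {t0..}"
      by (rule weighted_norm_integrable_on) (use assms(8,14) in \<open>auto simp: k_def\<close>)
  qed (use assms v in auto)
  obtain \<eta> where \<eta>: "\<eta> > 0" "\<And>z. z \<in> ball xs \<eta> \<Longrightarrow>
      F z - F xs \<le> (1 / \<gamma>1) * (gradient F z \<bullet> (z - xs))"
    using assms(15) xs unfolding H1_def inf by blast
  obtain K \<epsilon> where K: "K > 0" "\<epsilon> > 0" "\<And>z. z \<in> ball xs \<epsilon> \<Longrightarrow>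
      K * infdist z (minimizers F) powr \<gamma>2 \<le> F z - F xs"
    using assms(16) xs unfolding H2_def inf by blast
  have "\<exists>C T. \<forall>t\<ge>T. F (x t) - F xs \<le> C * t powr (- 2 * k)"
  proof (rule gap_decay[OF assms(11,12) _ assms(17) \<eta>(1) _ K(2,1)])
    show "k = (1 + \<theta>) / 2 * \<gamma>2 / (\<gamma>2 - 2)" by (simp add: k_def assms(13))
    show "F z - F xs \<le> 1 / \<gamma>1 * (gradient F z \<bullet> (z - xs))" if "norm (z - xs) < \<eta>" for z
      using \<eta>(2)[of z] that by (simp add: dist_norm norm_minus_commute)
    \<comment> \<open>The minimizer is unique, so the distance to the set of minimizers is the
      distance to \<open>xs\<close>.\<close>
    show "K * norm (z - xs) powr \<gamma>2 \<le> F z - F xs" if "norm (z - xs) < \<epsilon>" for z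
      using K(3)[of z] that by (simp add: dist_norm norm_minus_commute minimizers)
  qed
  then obtain C T where CT: "\<And>t. T \<le> t \<Longrightarrow> F (x t) - F xs \<le> C * t powr (- 2 * k)"
    by blast
  have "\<forall>\<^sub>F t in at_top. norm (F (x t) - inf_value F)
      \<le> C * norm (1 / t powr (2 * r * \<gamma>2 / (\<gamma>2 - 2)))"
    using eventually_ge_at_top[of T]
  proof eventually_elim
    case (elim t)
    have "t powr (- 2 * k) = 1 / t powr (2 * r * \<gamma>2 / (\<gamma>2 - 2))"
      by (simp add: k_def powr_minus_divide mult.assoc)
    then show ?case using CT[OF elim] gap_nonneg[of "x t"] by (simp add: inf)
  qed
  then show ?thesis by (rule bigoI)
qed

end
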